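(* Let $n_1,\dots,n_\ell$ be positive integers, $n=n_1+\dots+n_\ell$. Let $K_j\subset\mathbb{C}^{n_j}$ be compact and non-pluripolar for $j=1,\dots,\ell$, let $T\subset\mathbb{R}^\ell_+$ be compact convex and contain more than one point, and let $\{0\}\ne S_j\subset\mathbb{R}^{n_j}_+$ be compact convex and contain $0$ for $j=1,\dots,\ell$, such that $V^{S_j*}_{K_j}=0$ on $K_j$ for $j=1,\dots,\ell$. Let $K=K_1\times\dots\times K_\ell$ and $$S=\bigcup_{x\in T}(x_1S_1)\times\dots\times(x_\ell S_\ell)\subset\mathbb{R}^n_+.$$ Then there exist admissible weights $q_1,\dots,q_\ell$ on $K_1,\dots,K_\ell$, respectively, such that, with $q(z)=\varphi_T(q_1(z_1),\dots,q_\ell(z_\ell))$ for $z=(z_1,\dots,z_\ell)\in K$, one has for some $z=(z_1,\dots,z_\ell)\in\mathbb{C}^n$, $z_j\in\mathbb{C}^{n_j}$, $$V^S_{K,q}(z)>\varphi_T\big(V^{S_1}_{K_1,q_1}(z_1),\dots,V^{S_\ell}_{K_\ell,q_\ell}(z_\ell)\big).$$ Furthermore, if $T$ is a convex body, then for all constant weights $q_j<0$ on $K_j$, $j=1,\dots,\ell$, with $q=\varphi_T(q_1,\dots,q_\ell)$, this strict inequality holds for some $z\in\mathbb{C}^n$.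
   Context: $\mathbb{R}_+=[0,\infty)$, $\mathbb{C}^{*n}=(\mathbb{C}\setminus\{0\})^n$. A convex body is a compact convex set with non-empty interior. For compact convex $A\subset\mathbb{R}^m$, $\varphi_A(\xi)=\sup_{x\in A}\langle x,\xi\rangle$ is its supporting function. For $S\subset\mathbb{R}^n_+$ compact convex containing $0$, the logarithmic supporting function is $H_S(z)=\varphi_S(\log|z_1|,\dots,\log|z_n|)$ for $z\in\mathbb{C}^{*n}$, extended to $\mathbb{C}^n$ by $H_S(z)=\varlimsup_{\mathbb{C}^{*n}\ni w\to z}H_S(w)$. The Lelong class $\mathcal{L}^S(\mathbb{C}^n)$ consists of all plurisubharmonic $u$ on $\mathbb{C}^n$ such that $u\le H_S+c_u$ for some constant $c_u$. A weight on a compact $K\subset\mathbb{C}^n$ is a function $q:K\to\mathbb{R}\cup\{+\infty\}$; it is admissible if it is lower semicontinuous and $\{z\in K\,;\,q(z)<+\infty\}$ is non-pluripolar. The weighted Siciak-Zakharyuta function is $V^S_{K,q}(z)=\sup\{u(z)\,;\,u\in\mathcal{L}^S(\mathbb{C}^n),\ u|_K\le q\}$, and $V^S_K=V^S_{K,0}$. For a function $f$, $f^*$ denotes its upper semicontinuous regularization; $V^{S*}_K=(V^S_K)^*$. (The set $S$ in the claim is compact, convex and contains $0$.) *)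

theory Defs
  imports "HOL-Analysis.Analysis"
begin

text \<open>
  The dimensions \<open>n\<^sub>1, \<dots>, n\<^sub>\<ell>\<close> vary with the index, so they cannot be types. We fix one finite
  type \<open>'n\<close> of coordinates and realise the space \<open>\<complex>\<^sup>I\<close> with coordinates indexed by \<open>I :: 'n set\<close> as the
  coordinate subspace of \<^typ>\<open>complex ^ 'n\<close> on which the coordinates outside \<open>I\<close> vanish.
  A surjection \<open>b :: 'n \<Rightarrow> 'l\<close> splits the coordinates into nonempty blocks \<open>b -` {j}\<close>; the block \<open>j\<close>
  has \<open>n\<^sub>j = card (b -` {j}) \<ge> 1\<close> elements, and \<open>\<complex>\<^sup>n = UNIV\<close> is the internal product of the
  subspaces \<open>\<complex>\<^bsup>n\<^sub>j\<^esup>\<close>. Functions on \<open>\<complex>\<^sup>I\<close> are total functions on \<^typ>\<open>complex ^ 'n\<close>, of which only the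
  values on \<open>\<complex>\<^sup>I\<close> are used.
\<close>

definition coord_space :: "'n set \<Rightarrow> ('a::zero ^ 'n) set" where
  "coord_space I = {z. \<forall>i. i \<notin> I \<longrightarrow> z $ i = 0}"

definition coord_proj :: "'n set \<Rightarrow> 'a::zero ^ 'n \<Rightarrow> 'a ^ 'n" where
  "coord_proj I z = (\<chi> i. if i \<in> I then z $ i else 0)"

definition coord_torus :: "'n set \<Rightarrow> (complex ^ 'n) set" where
  "coord_torus I = {z \<in> coord_space I. \<forall>i\<in>I. z $ i \<noteq> 0}"

definition nonneg_orthant :: "'n set \<Rightarrow> (real ^ 'n) set" where
  "nonneg_orthant I = {s \<in> coord_space I. \<forall>i. 0 \<le> s $ i}"

definition block_prod :: "('n \<Rightarrow> 'l) \<Rightarrow> ('l \<Rightarrow> ('a::zero ^ 'n) set) \<Rightarrow> ('a ^ 'n) set" where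
  "block_prod b A = {z. \<forall>j. coord_proj (b -` {j}) z \<in> A j}"

definition convex_body :: "'a::euclidean_space set \<Rightarrow> bool" where
  "convex_body A \<longleftrightarrow> compact A \<and> convex A \<and> interior A \<noteq> {}"

text \<open>
  The supporting function is defined for extended real arguments because \<open>\<phi>\<^sub>T\<close> is applied to
  weights that may take the value \<open>+\<infinity>\<close>. The convention is \<open>0 \<cdot> \<infinity> = 0\<close>; for \<open>A\<close> in the nonnegative
  orthant and arguments \<open>> -\<infinity>\<close> this is the extension by monotone limits of the finite case.
\<close>

definition supp_fun :: "(real ^ 'm::finite) set \<Rightarrow> ('m \<Rightarrow> ereal) \<Rightarrow> ereal" where
  "supp_fun A \<xi> = (SUP x\<in>A. \<Sum>i\<in>UNIV. ereal (x $ i) * \<xi> i)"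

text \<open>
  For \<open>S \<subseteq> nonneg_orthant I\<close> and \<open>z \<in> coord_torus I\<close> the coordinates outside \<open>I\<close> contribute \<open>0\<close> to
  the pairing.
\<close>

definition log_supp_torus :: "(real ^ 'n::finite) set \<Rightarrow> complex ^ 'n \<Rightarrow> ereal" where
  "log_supp_torus S z = supp_fun S (\<lambda>i. ereal (ln (cmod (z $ i))))"

definition log_supp :: "'n set \<Rightarrow> (real ^ 'n::finite) set \<Rightarrow> complex ^ 'n \<Rightarrow> ereal" where
  "log_supp I S z =
    (if z \<in> coord_torus I then log_supp_torus S z
     else Limsup (at z within coord_torus I) (log_supp_torus S))"

definition usc_on :: "'a::topological_space set \<Rightarrow> ('a \<Rightarrow> ereal) \<Rightarrow> bool" where
  "usc_on X f \<longleftrightarrow> (\<forall>c. openin (top_of_set X) {x \<in> X. f x < c})"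

definition lsc_on :: "'a::topological_space set \<Rightarrow> ('a \<Rightarrow> ereal) \<Rightarrow> bool" where
  "lsc_on X f \<longleftrightarrow> (\<forall>c. openin (top_of_set X) {x \<in> X. c < f x})"

text \<open>
  The filter is that of all neighbourhoods of \<open>z\<close> in \<open>X\<close>, not of punctured ones, so that the
  regularization dominates \<open>f\<close>.
\<close>

definition usc_reg :: "'a::topological_space set \<Rightarrow> ('a \<Rightarrow> ereal) \<Rightarrow> 'a \<Rightarrow> ereal" where
  "usc_reg X f z = Limsup (inf (nhds z) (principal X)) f"

text \<open>
  Mean value of \<open>u\<close> over the circle \<open>{a + e\<^sup>i\<^sup>\<theta> w}\<close>. As \<^const>\<open>e2ennreal\<close> truncates negative arguments to
  \<open>0\<close>, the two integrals are those of the positive and the negative part; the first one is finite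
  when \<open>u < \<infinity>\<close> is upper semicontinuous.
\<close>

definition circle_mean :: "(complex ^ 'n::finite \<Rightarrow> ereal) \<Rightarrow> complex ^ 'n \<Rightarrow> complex ^ 'n \<Rightarrow> ereal" where
  "circle_mean u a w =
    ereal (1 / (2 * pi)) *
      (enn2ereal (\<integral>\<^sup>+\<theta>\<in>{0..2*pi}. e2ennreal (u (a + cis \<theta> *s w)) \<partial>lborel) -
       enn2ereal (\<integral>\<^sup>+\<theta>\<in>{0..2*pi}. e2ennreal (- u (a + cis \<theta> *s w)) \<partial>lborel))"

text \<open>The constant \<open>-\<infinity>\<close> is admitted as a plurisubharmonic function.\<close>

definition psh :: "'n set \<Rightarrow> (complex ^ 'n::finite \<Rightarrow> ereal) \<Rightarrow> bool" where
  "psh I u \<longleftrightarrow>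
    (\<forall>z\<in>coord_space I. u z < \<infinity>) \<and>
    usc_on (coord_space I) u \<and>
    (\<forall>a\<in>coord_space I. \<forall>w\<in>coord_space I. u a \<le> circle_mean u a w)"

definition pluripolar :: "'n set \<Rightarrow> (complex ^ 'n::finite) set \<Rightarrow> bool" where
  "pluripolar I E \<longleftrightarrow>
    (\<exists>u. psh I u \<and> (\<exists>z\<in>coord_space I. u z \<noteq> -\<infinity>) \<and> (\<forall>z\<in>E. u z = -\<infinity>))"

definition lelong_class :: "'n set \<Rightarrow> (real ^ 'n::finite) set \<Rightarrow> (complex ^ 'n \<Rightarrow> ereal) set" where
  "lelong_class I S =
    {u. psh I u \<and> (\<exists>c::real. \<forall>z\<in>coord_space I. u z \<le> log_supp I S z + ereal c)}"

definition admissible_weight ::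
    "'n set \<Rightarrow> (complex ^ 'n::finite) set \<Rightarrow> (complex ^ 'n \<Rightarrow> ereal) \<Rightarrow> bool" where
  "admissible_weight I K q \<longleftrightarrow>
    (\<forall>z\<in>K. q z \<noteq> -\<infinity>) \<and> lsc_on K q \<and> \<not> pluripolar I {z \<in> K. q z < \<infinity>}"

definition siciak_zakharyuta ::
    "'n set \<Rightarrow> (real ^ 'n::finite) set \<Rightarrow> (complex ^ 'n) set \<Rightarrow> (complex ^ 'n \<Rightarrow> ereal)
      \<Rightarrow> complex ^ 'n \<Rightarrow> ereal" where
  "siciak_zakharyuta I S K q z =
    (SUP u\<in>{u \<in> lelong_class I S. \<forall>w\<in>K. u w \<le> q w}. u z)"

end

theory Submission
  imports Defs "HOL-Complex_Analysis.Cauchy_Integral_Formula"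
begin

text \<open>
  Both inequalities come from constant weights \<open>c\<^sub>j \<le> 0\<close>. Write \<open>V\<^sub>j\<close> for the unweighted extremal function
  of \<open>K\<^sub>j\<close>. A constant weight shifts an extremal function by that constant, so the weighted function of
  the factor is at most \<open>V\<^sub>j + c\<^sub>j\<close> (lemma \<open>siciak_shift_le\<close>). On the product, \<open>\<phi>\<^sub>T\<close> of the weights is a
  constant as well, and the extremal function there is at least \<open>\<phi>\<^sub>T(V\<^sub>1, \<dots>, V\<^sub>\<ell>) + \<phi>\<^sub>T(c)\<close>, because
  \<open>\<Sum>\<^sub>j x\<^sub>j u\<^sub>j(z\<^sub>j)\<close> belongs to the Lelong class of \<open>S\<close> whenever \<open>x \<in> T\<close> and the \<open>u\<^sub>j\<close> belong to those of
  the \<open>S\<^sub>j\<close> (lemmas \<open>competitor_block_sum\<close> and \<open>siciak_block_prod_ge\<close>). It remains to find \<open>z\<close> for which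
  \<open>\<phi>\<^sub>T(A + c) < \<phi>\<^sub>T(A) + \<phi>\<^sub>T(c)\<close> with \<open>A\<^sub>j = V\<^sub>j(z\<^sub>j)\<close>.

  Equality holds in this sublinearity estimate only if a single point of \<open>T\<close> maximizes both pairings
  \<open>\<langle>x, A\<rangle>\<close> and \<open>\<langle>x, c\<rangle>\<close>. If \<open>c\<close> is not constant on \<open>T\<close>, this is impossible for \<open>A\<close> close to the direction
  \<open>-c\<close>, and a bounded error is harmless once \<open>A\<close> is far out in that direction (lemma \<open>supp_fun_gap\<close>).

  Such values of \<open>A\<close> are found on complex lines through a point of \<open>K\<^sub>j\<close> in the diagonal direction: there
  \<open>V\<^sub>j\<close> equals \<open>\<sigma>\<^sub>j log |\<zeta>| + O(1)\<close>, with \<open>\<sigma>\<^sub>j > 0\<close> the maximum of \<open>s\<^sub>1 + \<dots> + s\<^bsub>n\<^sub>j\<^esub>\<close> over \<open>S\<^sub>j\<close> (lemma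
  \<open>siciak_line_growth\<close>). The lower bound uses the function \<open>max(0, \<Sum>\<^sub>i s\<^sub>i log |z\<^sub>i|)\<close> for a maximizing
  \<open>s\<close>. For the upper bound, the vanishing of the regularized \<open>V\<^sub>j\<close> on \<open>K\<^sub>j\<close> makes every candidate at most
  \<open>1\<close> near the base point, and the maximum principle outside a disc carries this bound along the line
  (lemma \<open>log_growth_outside_disc\<close>).

  Finally, if \<open>T\<close> has two points that differ in the coordinate \<open>j\<close>, the choice \<open>c = -e\<^sub>j\<close> is not constant on
  \<open>T\<close>; and if \<open>T\<close> is a convex body, no nonzero \<open>c\<close> is constant on \<open>T\<close>.
\<close>

section \<open>Upper semicontinuity and the maximum principle in one variable\<close>

definition real_usc :: "'a::topological_space set \<Rightarrow> ('a \<Rightarrow> real) \<Rightarrow> bool" where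
  "real_usc X f \<longleftrightarrow> (\<forall>c. openin (top_of_set X) {x \<in> X. f x < c})"

lemma real_usc_continuous:
  assumes "continuous_on X f"
  shows "real_usc X f"
  unfolding real_usc_def
proof
  fix c :: real
  have "openin (top_of_set X) (X \<inter> f -` {..<c})"
    by (rule continuous_openin_preimage_gen[OF assms]) simp
  then show "openin (top_of_set X) {x \<in> X. f x < c}"
    by (simp add: vimage_def Collect_conj_eq lessThan_def)
qed

lemma real_usc_add:
  assumes "real_usc X f" "real_usc X g"
  shows "real_usc X (\<lambda>x. f x + g x)"
  unfolding real_usc_def
proof
  fix c :: real
  have "{x \<in> X. f x + g x < c} = (\<Union>r. {x \<in> X. f x < r} \<inter> {x \<in> X. g x < c - r})"
  proof (intro equalityI subsetI)
    fix x assume x: "x \<in> {x \<in> X. f x + g x < c}"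
    then have "f x < c - g x" by simp
    then obtain r where "f x < r" "r < c - g x" using dense by blast
    then show "x \<in> (\<Union>r. {x \<in> X. f x < r} \<inter> {x \<in> X. g x < c - r})"
      using x by auto
  qed auto
  moreover have "openin (top_of_set X) \<dots>"
    using assms unfolding real_usc_def by (intro openin_Union) auto
  ultimately show "openin (top_of_set X) {x \<in> X. f x + g x < c}" by simp
qed

lemma real_usc_compose:
  assumes "real_usc Y f" "continuous_on X g" "g ` X \<subseteq> Y"
  shows "real_usc X (\<lambda>x. f (g x))"
  unfolding real_usc_def
proof
  fix c :: real
  have "openin (top_of_set X) (X \<inter> g -` {y \<in> Y. f y < c})"
    using assms unfolding real_usc_def by (intro continuous_openin_preimage[of _ _ Y]) auto
  moreover have "X \<inter> g -` {y \<in> Y. f y < c} = {x \<in> X. f (g x) < c}"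
    using assms(3) by auto
  ultimately show "openin (top_of_set X) {x \<in> X. f (g x) < c}" by simp
qed

lemma real_usc_attains_max:
  assumes "compact X" "X \<noteq> {}" "real_usc X f"
  shows "\<exists>x\<in>X. \<forall>y\<in>X. f y \<le> f x"
proof (rule ccontr)
  assume "\<not> ?thesis"
  then have *: "\<forall>x\<in>X. \<exists>y\<in>X. f x < f y" by (auto simp: not_le)
  have "\<forall>y\<in>X. \<exists>U. open U \<and> {x \<in> X. f x < f y} = X \<inter> U"
    using assms(3) unfolding real_usc_def openin_open by auto
  then obtain U where U: "\<And>y. y \<in> X \<Longrightarrow> open (U y)"
      "\<And>y. y \<in> X \<Longrightarrow> {x \<in> X. f x < f y} = X \<inter> U y"
    by metis
  have "X \<subseteq> (\<Union>y\<in>X. U y)" using * U(2) by blast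
  then obtain Y where Y: "Y \<subseteq> X" "finite Y" "X \<subseteq> (\<Union>y\<in>Y. U y)"
    using compactE_image[OF assms(1), of X U] U(1) by blast
  have "Y \<noteq> {}" using Y assms(2) by auto
  then have "Max (f ` Y) \<in> f ` Y" using Y(2) by (intro Max_in) auto
  then obtain y where "y \<in> Y" "f y = Max (f ` Y)" by auto
  then have y: "y \<in> Y" "\<forall>x\<in>Y. f x \<le> f y" using Y(2) by auto
  from y(1) obtain y' where "y' \<in> Y" "y \<in> U y'" using Y by blast
  then have "f y < f y'" using U(2)[of y'] Y y by blast
  with y \<open>y' \<in> Y\<close> show False by force
qed

text \<open>
  After division by \<open>\<alpha>\<close> the integrand is the real part of \<open>Ln (1 + \<gamma> z)\<close> with \<open>cmod \<gamma> < 1\<close>. This function is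
  holomorphic on the closed unit disc and vanishes at the centre, so Cauchy's formula applies.
\<close>

lemma mean_ln_cmod_circle:
  fixes \<alpha> \<beta> :: complex
  assumes "cmod \<beta> < cmod \<alpha>"
  shows "((\<lambda>\<theta>. ln (cmod (\<alpha> + \<beta> * cis \<theta>))) has_integral 2 * pi * ln (cmod \<alpha>)) {0..2*pi}"
proof -
  have \<alpha>: "\<alpha> \<noteq> 0" using assms by auto
  define \<gamma> where "\<gamma> = \<beta> / \<alpha>"
  have \<gamma>: "cmod \<gamma> < 1" using assms \<alpha> by (simp add: \<gamma>_def norm_divide)
  have Re: "0 < Re (1 + \<gamma> * z)" if "cmod z \<le> 1" for z
  proof -
    have "cmod (\<gamma> * z) < 1" using that \<gamma>
      by (metis norm_ge_zero norm_mult mult_left_le order.strict_trans1)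
    then show ?thesis using abs_Re_le_cmod[of "\<gamma> * z"] by simp
  qed
  have hol: "(\<lambda>z. Ln (1 + \<gamma> * z)) holomorphic_on cball 0 1"
    using Re by (intro holomorphic_intros) (force simp: complex_nonpos_Reals_iff simp del: plus_complex.sel)
  have "((\<lambda>u. Ln (1 + \<gamma> * u) / (u - 0)) has_contour_integral (2 * of_real pi * \<i> * Ln (1 + \<gamma> * 0))) (circlepath 0 1)"
    by (rule Cauchy_integral_circlepath_simple[OF hol]) simp
  then have "((\<lambda>u. Ln (1 + \<gamma> * u) / u) has_contour_integral 0) (part_circlepath 0 1 0 (2*pi))"
    by (simp add: circlepath_def)
  then have "((\<lambda>t. \<i> * Ln (1 + \<gamma> * cis t)) has_integral 0) {0..2*pi}"
    by (subst (asm) has_contour_integral_part_circlepath_iff) (simp_all add: mult_ac)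
  then have "((\<lambda>t. - \<i> * (\<i> * Ln (1 + \<gamma> * cis t))) has_integral - \<i> * 0) {0..2*pi}"
    by (rule has_integral_mult_right)
  then have "((\<lambda>t. Re (Ln (1 + \<gamma> * cis t))) has_integral 0) {0..2*pi}"
    using has_integral_Re[of "\<lambda>t. - \<i> * (\<i> * Ln (1 + \<gamma> * cis t))" "- \<i> * 0"]
    by (simp add: mult.assoc[symmetric])
  moreover have "((\<lambda>t::real. ln (cmod \<alpha>)) has_integral 2 * pi * ln (cmod \<alpha>)) {0..2*pi}"
    using has_integral_const_real[of "ln (cmod \<alpha>)" 0 "2*pi"] by simp
  ultimately have "((\<lambda>t. Re (Ln (1 + \<gamma> * cis t)) + ln (cmod \<alpha>)) has_integral 0 + 2 * pi * ln (cmod \<alpha>)) {0..2*pi}"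
    by (rule has_integral_add)
  moreover have "Re (Ln (1 + \<gamma> * cis t)) + ln (cmod \<alpha>) = ln (cmod (\<alpha> + \<beta> * cis t))" for t
  proof -
    have nz: "1 + \<gamma> * cis t \<noteq> 0" using Re[of "cis t"] by (metis norm_cis order.refl zero_complex.sel(1) less_irrefl)
    have "\<alpha> + \<beta> * cis t = \<alpha> * (1 + \<gamma> * cis t)" using \<alpha> by (simp add: \<gamma>_def field_simps)
    then show ?thesis using nz \<alpha> by (simp add: norm_mult ln_mult)
  qed
  ultimately show ?thesis by simp
qed

text \<open>
  Jensen's inequality for a linear function without zeros on the circle. If \<open>\<beta>\<close> dominates, conjugation and
  multiplication by \<open>cis \<theta>\<close>, which preserve absolute values on the circle, exchange the two coefficients, and
  the mean becomes \<open>ln (cmod \<beta>)\<close>.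
\<close>

lemma mean_ln_cmod_circle_ge:
  fixes \<alpha> \<beta> :: complex
  assumes "\<alpha> \<noteq> 0" "cmod \<beta> \<noteq> cmod \<alpha>"
  shows "\<exists>m\<ge>2 * pi * ln (cmod \<alpha>). ((\<lambda>\<theta>. ln (cmod (\<alpha> + \<beta> * cis \<theta>))) has_integral m) {0..2*pi}"
proof (cases "cmod \<beta> < cmod \<alpha>")
  case True
  then show ?thesis using mean_ln_cmod_circle by blast
next
  case False
  then have lt: "cmod \<alpha> < cmod \<beta>" using assms by simp
  then have "((\<lambda>\<theta>. ln (cmod (cnj \<beta> + cnj \<alpha> * cis \<theta>))) has_integral 2 * pi * ln (cmod \<beta>)) {0..2*pi}"
    using mean_ln_cmod_circle[of "cnj \<alpha>" "cnj \<beta>"] by simp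
  moreover have "cmod (cnj \<beta> + cnj \<alpha> * cis t) = cmod (\<alpha> + \<beta> * cis t)" for t
  proof -
    have "cmod (cnj \<beta> + cnj \<alpha> * cis t) = cmod (cnj (cnj \<beta> + cnj \<alpha> * cis t) * cis t)"
      by (simp add: norm_mult del: complex_cnj_add)
    also have "cnj (cnj \<beta> + cnj \<alpha> * cis t) * cis t = \<alpha> + \<beta> * cis t"
      by (simp add: cis_cnj cis_mult algebra_simps)
    finally show ?thesis .
  qed
  moreover have "ln (cmod \<alpha>) \<le> ln (cmod \<beta>)"
    using lt assms(1) by (intro ln_mono) auto
  ultimately show ?thesis by (intro exI[of _ "2 * pi * ln (cmod \<beta>)"]) auto
qed

lemma mean_cmod_square_circle:
  fixes z :: complex and r :: real
  shows "((\<lambda>\<theta>. (cmod (z + of_real r * cis \<theta>))\<^sup>2) has_integral 2 * pi * ((cmod z)\<^sup>2 + r\<^sup>2)) {0..2*pi}"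
proof -
  define F where "F = (\<lambda>\<theta>. ((cmod z)\<^sup>2 + r\<^sup>2) * \<theta> + 2 * r * (Re z * sin \<theta> - Im z * cos \<theta>))"
  have eq: "(cmod (z + of_real r * cis \<theta>))\<^sup>2 = (cmod z)\<^sup>2 + r\<^sup>2 + 2 * r * (Re z * cos \<theta> + Im z * sin \<theta>)" for \<theta>
  proof -
    have "r\<^sup>2 * (cos \<theta>)\<^sup>2 + r\<^sup>2 * (sin \<theta>)\<^sup>2 = r\<^sup>2"
      by (metis sin_cos_squared_add2 distrib_left mult.right_neutral)
    then show ?thesis unfolding cmod_power2 by (simp add: power2_sum power_mult_distrib algebra_simps)
  qed
  have "((\<lambda>\<theta>. (cmod (z + of_real r * cis \<theta>))\<^sup>2) has_integral F (2*pi) - F 0) {0..2*pi}"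
    unfolding eq F_def
    by (rule fundamental_theorem_of_calculus)
       (auto intro!: derivative_eq_intros simp: has_real_derivative_iff_has_vector_derivative[symmetric] algebra_simps)
  then show ?thesis by (simp add: F_def algebra_simps)
qed

lemma real_le_of_eps_mult:
  fixes x y b :: real
  assumes "\<And>e. 0 < e \<Longrightarrow> x \<le> y + e * b"
  shows "x \<le> y"
proof (rule field_le_epsilon)
  fix e :: real assume e: "0 < e"
  have "x \<le> y + e / (\<bar>b\<bar> + 1) * b" using e by (intro assms) simp
  also have "e / (\<bar>b\<bar> + 1) * b \<le> e / (\<bar>b\<bar> + 1) * (\<bar>b\<bar> + 1)"
    using e by (intro mult_left_mono) auto
  also have "\<dots> = e" by simp
  finally show "x \<le> y + e" by simp
qed

text \<open>
  Maximum principle in the exterior of a disc for a subharmonic function of logarithmic growth. The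
  comparison function is \<open>M + (\<sigma> + e) ln (cmod w / \<delta>) + \<eta> (R'\<^sup>2 - (cmod w)\<^sup>2)\<close> on an annulus. The slope \<open>e\<close>
  makes it dominate \<open>v\<close> on the outer circle, whatever the constant \<open>C\<close>; the quadratic term makes it strictly
  superharmonic, so that an interior maximum of the difference is excluded by comparing two mean values.
  The bound follows as \<open>\<eta>\<close> and then \<open>e\<close> tend to \<open>0\<close>. The submean property is assumed in the form that
  tests \<open>v\<close> against continuous majorants on circles.
\<close>

lemma log_growth_outside_disc:
  fixes v :: "complex \<Rightarrow> real"
  assumes usc: "real_usc UNIV v"
    and mean: "\<And>z r h. continuous_on {0..2*pi} h \<Longrightarrow>
      (\<And>\<theta>. v (z + of_real r * cis \<theta>) \<le> h \<theta>) \<Longrightarrow> 2 * pi * v z \<le> integral {0..2*pi} h"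
    and \<delta>: "0 < \<delta>" "\<And>z. cmod z = \<delta> \<Longrightarrow> v z \<le> M"
    and growth: "\<And>z. R \<le> cmod z \<Longrightarrow> v z \<le> \<sigma> * ln (cmod z) + C"
    and z: "\<delta> \<le> cmod z"
  shows "v z \<le> M + \<sigma> * ln (cmod z / \<delta>)"
proof (rule real_le_of_eps_mult)
  fix e :: real assume e: "0 < e"
  define R' where "R' = Max {R, cmod z, \<delta>, exp ((C - M + (\<sigma> + e) * ln \<delta>) / e)}"
  have R': "R \<le> R'" "cmod z \<le> R'" "\<delta> \<le> R'" "exp ((C - M + (\<sigma> + e) * ln \<delta>) / e) \<le> R'"
    by (auto simp: R'_def)
  have R'0: "0 < R'" using R'(3) \<delta> by simp
  have lnR': "(C - M + (\<sigma> + e) * ln \<delta>) / e \<le> ln R'"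
    using R'(4) R'0 ln_ge_iff by blast
  then have far: "\<sigma> * ln R' + C \<le> M + (\<sigma> + e) * (ln R' - ln \<delta>)"
    using e by (simp add: field_simps)
  show "v z \<le> M + \<sigma> * ln (cmod z / \<delta>) + e * ln (cmod z / \<delta>)"
  proof (rule real_le_of_eps_mult)
    fix \<eta> :: real assume \<eta>: "0 < \<eta>"
    define h where "h = (\<lambda>w. M + (\<sigma> + e) * (ln (cmod w) - ln \<delta>) + \<eta> * (R'\<^sup>2 - (cmod w)\<^sup>2))"
    define X where "X = {w. \<delta> \<le> cmod w \<and> cmod w \<le> R'}"
    have X_eq: "X = cball 0 R' - ball 0 \<delta>" by (auto simp: X_def)
    have compX: "compact X" unfolding X_eq by (simp add: compact_diff)
    have zX: "z \<in> X" using z R' by (auto simp: X_def)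
    have conth: "continuous_on X h" unfolding h_def
      using \<delta>(1) by (intro continuous_intros) (auto simp: X_def)
    have "real_usc X v" using real_usc_compose[OF usc, of X "\<lambda>x. x"] by simp
    then have "real_usc X (\<lambda>w. v w + - h w)"
      using conth by (intro real_usc_add[OF _ real_usc_continuous] continuous_on_minus)
    then obtain p where p: "p \<in> X" "\<And>w. w \<in> X \<Longrightarrow> v w - h w \<le> v p - h p"
      using real_usc_attains_max[OF compX] zX by fastforce
    have "v p - h p \<le> 0"
    proof (cases "cmod p = \<delta> \<or> cmod p = R'")
      case True
      then show ?thesis
      proof
        assume d: "cmod p = \<delta>"
        have "\<delta>\<^sup>2 \<le> R'\<^sup>2" using R' \<delta> by (simp add: power_mono)
        then have "0 \<le> \<eta> * (R'\<^sup>2 - \<delta>\<^sup>2)" using \<eta> by simp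
        then show ?thesis using \<delta>(2)[OF d] d \<eta> by (simp add: h_def)
      next
        assume d: "cmod p = R'"
        then have "v p \<le> \<sigma> * ln R' + C" using growth[of p] R' by simp
        then show ?thesis using far d by (simp add: h_def)
      qed
    next
      case False
      \<comment> \<open>At an interior maximum of \<open>v - h\<close> the mean value of \<open>h\<close> over a small circle would be at least \<open>h p\<close>,
        but \<open>h\<close> is strictly superharmonic.\<close>
      then have pi: "\<delta> < cmod p" "cmod p < R'" using p(1) by (auto simp: X_def)
      define r where "r = min (cmod p - \<delta>) (R' - cmod p)"
      have r: "0 < r" "r \<le> cmod p - \<delta>" "r \<le> R' - cmod p" using pi by (auto simp: r_def)
      define k where "k = (\<lambda>\<theta>. h (p + of_real r * cis \<theta>) + (v p - h p))"
      have inX: "p + of_real r * cis \<theta> \<in> X" for \<theta>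
        using r norm_triangle_ineq[of p "of_real r * cis \<theta>"] norm_diff_ineq[of p "of_real r * cis \<theta>"]
        by (auto simp: X_def norm_mult)
      have bound: "v (p + of_real r * cis \<theta>) \<le> k \<theta>" for \<theta>
        using p(2)[OF inX[of \<theta>]] by (simp add: k_def)
      have contk: "continuous_on {0..2*pi} k" unfolding k_def
        by (intro continuous_intros continuous_on_compose2[OF conth]) (use inX in auto)
      have ln_int: "((\<lambda>\<theta>. ln (cmod (p + of_real r * cis \<theta>))) has_integral 2 * pi * ln (cmod p)) {0..2*pi}"
        using r \<delta> by (intro mean_ln_cmod_circle) simp
      have c_int: "((\<lambda>\<theta>. c) has_integral 2 * pi * c) {0..2*pi}" for c :: real
        using has_integral_const_real[of c 0 "2*pi"] by simp
      have "(k has_integral (2*pi*M + (\<sigma> + e) * (2*pi*ln (cmod p) - 2*pi*ln \<delta>)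
              + \<eta> * (2*pi*R'\<^sup>2 - 2*pi*((cmod p)\<^sup>2 + r\<^sup>2))) + 2*pi*(v p - h p)) {0..2*pi}"
        unfolding k_def h_def
        by (intro has_integral_add has_integral_diff has_integral_mult_right c_int ln_int
              mean_cmod_square_circle)
      then have "integral {0..2*pi} k = (2*pi*M + (\<sigma> + e) * (2*pi*ln (cmod p) - 2*pi*ln \<delta>)
              + \<eta> * (2*pi*R'\<^sup>2 - 2*pi*((cmod p)\<^sup>2 + r\<^sup>2))) + 2*pi*(v p - h p)"
        by (rule integral_unique)
      also have "\<dots> = 2 * pi * (v p - \<eta> * r\<^sup>2)"
        by (simp add: h_def algebra_simps)
      finally have "2 * pi * v p \<le> 2 * pi * (v p - \<eta> * r\<^sup>2)"
        using mean[OF contk bound] by simp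
      then have "\<eta> * r\<^sup>2 \<le> 0" by (simp add: mult_le_cancel_left)
      then show ?thesis using \<eta> r(1) by (simp add: mult_le_0_iff)
    qed
    then have "v z \<le> h z" using p(2)[OF zX] by simp
    moreover have "ln (cmod z / \<delta>) = ln (cmod z) - ln \<delta>"
      using z \<delta>(1) by (subst ln_divide_pos) auto
    ultimately show "v z \<le> M + \<sigma> * ln (cmod z / \<delta>) + e * ln (cmod z / \<delta>) + \<eta> * (R'\<^sup>2 - (cmod z)\<^sup>2)"
      unfolding h_def by (simp add: distrib_right)
  qed
qed

section \<open>Nonnegative plurisubharmonic functions\<close>

abbreviation pos_real :: "ereal \<Rightarrow> real" where
  "pos_real x \<equiv> real_of_ereal (max 0 x)"

abbreviation circle_nn :: "(real \<Rightarrow> ennreal) \<Rightarrow> ennreal" where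
  "circle_nn f \<equiv> (\<integral>\<^sup>+\<theta>\<in>{0..2*pi}. f \<theta> \<partial>lborel)"

lemma circle_nn_const: "0 \<le> c \<Longrightarrow> circle_nn (\<lambda>_. ennreal c) = ennreal (2 * pi * c)"
  by (simp add: nn_integral_cmult_indicator ennreal_mult'[symmetric] mult.commute)

lemma circle_nn_mono:
  "(\<And>\<theta>. f \<theta> \<le> g \<theta>) \<Longrightarrow> circle_nn f \<le> circle_nn g"
  by (intro nn_integral_mono mult_right_mono) auto

lemma circle_nn_add:
  assumes [measurable]: "f \<in> borel_measurable borel" "g \<in> borel_measurable borel"
  shows "circle_nn (\<lambda>\<theta>. f \<theta> + g \<theta>) = circle_nn f + circle_nn g"
proof -
  have "circle_nn (\<lambda>\<theta>. f \<theta> + g \<theta>) =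
      (\<integral>\<^sup>+\<theta>. f \<theta> * indicator {0..2*pi} \<theta> + g \<theta> * indicator {0..2*pi} \<theta> \<partial>lborel)"
    by (intro nn_integral_cong) (simp add: distrib_right)
  then show ?thesis by (simp add: nn_integral_add)
qed

lemma circle_nn_continuous:
  fixes h :: "real \<Rightarrow> real"
  assumes "continuous_on {0..2*pi} h" "\<And>\<theta>. 0 \<le> h \<theta>"
  shows "circle_nn (\<lambda>\<theta>. ennreal (h \<theta>)) = ennreal (integral {0..2*pi} h)"
  using assms
  by (intro nn_integral_has_integral_lebesgue' integrable_integral integrable_continuous_real) auto

lemma coord_space_add: "a \<in> coord_space I \<Longrightarrow> w \<in> coord_space I \<Longrightarrow> a + w \<in> coord_space I"
  for a w :: "complex ^ 'n"
  by (simp add: coord_space_def)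

lemma coord_space_vmult: "w \<in> coord_space I \<Longrightarrow> c *s w \<in> coord_space I"
  for w :: "complex ^ 'n"
  by (simp add: coord_space_def)

lemma coord_proj_in: "coord_proj I z \<in> coord_space I"
  by (simp add: coord_proj_def coord_space_def)

lemma coord_proj_line: "coord_proj I (a + c *s w) = coord_proj I a + c *s coord_proj I w"
  for a w :: "complex ^ 'n"
  by (simp add: coord_proj_def vec_eq_iff)

lemma continuous_on_coord_proj: "continuous_on X (coord_proj I :: complex ^ 'n \<Rightarrow> _)"
  unfolding coord_proj_def
proof (intro continuous_on_vec_lambda)
  fix i :: 'n
  show "continuous_on X (\<lambda>z::complex^'n. if i \<in> I then z $ i else 0)"
    by (cases "i \<in> I") (auto intro!: continuous_intros)
qed

lemma continuous_on_line: "continuous_on X (\<lambda>c. a + c *s w)"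
  for a w :: "complex ^ 'n"
  unfolding vector_scalar_mult_def
  by (intro continuous_intros continuous_on_vec_lambda)

lemma continuous_on_circle: "continuous_on X (\<lambda>\<theta>. a + cis \<theta> *s w)"
  for a w :: "complex ^ 'n"
  by (rule continuous_on_compose2[OF continuous_on_line[of UNIV]]) (auto intro!: continuous_intros)

text \<open>
  Nonnegative plurisubharmonic functions on \<open>coord_space I\<close>, as real functions: for them the circle mean
  is a single integral, and sums, multiples and pullbacks reduce to linearity of that integral. Since
  \<open>0 \<in> S\<close>, the candidates for an extremal function with a nonpositive constant weight can be replaced by
  larger ones of the form \<open>f - k\<close> with \<open>f\<close> nonnegative.
\<close>

definition nonneg_psh :: "'n set \<Rightarrow> (complex ^ 'n::finite \<Rightarrow> real) \<Rightarrow> bool" where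
  "nonneg_psh I f \<longleftrightarrow>
    (\<forall>z. 0 \<le> f z) \<and> real_usc (coord_space I) f \<and>
    (\<forall>a\<in>coord_space I. \<forall>w\<in>coord_space I.
      ennreal (2 * pi * f a) \<le> circle_nn (\<lambda>\<theta>. ennreal (f (a + cis \<theta> *s w))))"

lemma real_usc_circle_measurable:
  fixes a w :: "complex ^ 'n::finite"
  assumes "real_usc (coord_space I) f" "a \<in> coord_space I" "w \<in> coord_space I"
  shows "(\<lambda>\<theta>. f (a + cis \<theta> *s w)) \<in> borel_measurable borel"
proof (rule borel_measurableI_less)
  fix c
  have "real_usc UNIV (\<lambda>\<theta>. f (a + cis \<theta> *s w))"
    using assms by (intro real_usc_compose[OF assms(1)] continuous_on_circle)
      (auto intro: coord_space_add coord_space_vmult)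
  then show "{\<theta> \<in> space borel. f (a + cis \<theta> *s w) < c} \<in> sets borel"
    by (simp add: real_usc_def)
qed

lemma nonneg_psh_const: "0 \<le> c \<Longrightarrow> nonneg_psh I (\<lambda>_. c)"
  by (auto simp: nonneg_psh_def circle_nn_const intro!: real_usc_continuous)

lemma nonneg_psh_add:
  assumes "nonneg_psh I f" "nonneg_psh I g"
  shows "nonneg_psh I (\<lambda>z. f z + g z)"
proof -
  have nonneg: "0 \<le> f z" "0 \<le> g z" for z
    using assms by (auto simp: nonneg_psh_def)
  have "ennreal (2 * pi * (f a + g a)) \<le> circle_nn (\<lambda>\<theta>. ennreal (f (a + cis \<theta> *s w) + g (a + cis \<theta> *s w)))"
    if "a \<in> coord_space I" "w \<in> coord_space I" for a w
  proof -
    have [measurable]: "(\<lambda>\<theta>. f (a + cis \<theta> *s w)) \<in> borel_measurable borel"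
        "(\<lambda>\<theta>. g (a + cis \<theta> *s w)) \<in> borel_measurable borel"
      using assms that by (auto simp: nonneg_psh_def intro: real_usc_circle_measurable)
    have "ennreal (2 * pi * (f a + g a)) = ennreal (2 * pi * f a) + ennreal (2 * pi * g a)"
      using nonneg by (simp add: distrib_left)
    also have "\<dots> \<le> circle_nn (\<lambda>\<theta>. ennreal (f (a + cis \<theta> *s w))) + circle_nn (\<lambda>\<theta>. ennreal (g (a + cis \<theta> *s w)))"
      using assms that by (intro add_mono) (auto simp: nonneg_psh_def)
    also have "\<dots> = circle_nn (\<lambda>\<theta>. ennreal (f (a + cis \<theta> *s w)) + ennreal (g (a + cis \<theta> *s w)))"
      by (rule circle_nn_add[symmetric]) measurable
    also have "\<dots> = circle_nn (\<lambda>\<theta>. ennreal (f (a + cis \<theta> *s w) + g (a + cis \<theta> *s w)))"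
      using nonneg by simp
    finally show ?thesis .
  qed
  with assms nonneg show ?thesis
    unfolding nonneg_psh_def by (intro conjI real_usc_add) auto
qed

lemma nonneg_psh_cmult:
  assumes "nonneg_psh I f" "0 \<le> c"
  shows "nonneg_psh I (\<lambda>z. c * f z)"
proof (cases "c = 0")
  case True
  then show ?thesis by (simp add: nonneg_psh_const)
next
  case False
  then have c: "0 < c" using assms(2) by simp
  have "{x \<in> coord_space I. c * f x < r} = {x \<in> coord_space I. f x < r / c}" for r
    using c by (simp add: field_simps)
  then have "real_usc (coord_space I) (\<lambda>z. c * f z)"
    using assms(1) by (simp add: nonneg_psh_def real_usc_def)
  moreover have "ennreal (2 * pi * (c * f a)) \<le> circle_nn (\<lambda>\<theta>. ennreal (c * f (a + cis \<theta> *s w)))"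
    if "a \<in> coord_space I" "w \<in> coord_space I" for a w
  proof -
    have [measurable]: "(\<lambda>\<theta>. f (a + cis \<theta> *s w)) \<in> borel_measurable borel"
      using assms that by (auto simp: nonneg_psh_def intro: real_usc_circle_measurable)
    have "ennreal (2 * pi * (c * f a)) = ennreal c * ennreal (2 * pi * f a)"
      using c by (subst ennreal_mult'[symmetric]) (auto simp: mult_ac)
    also have "\<dots> \<le> ennreal c * circle_nn (\<lambda>\<theta>. ennreal (f (a + cis \<theta> *s w)))"
      using assms that by (intro mult_left_mono) (auto simp: nonneg_psh_def)
    also have "\<dots> = (\<integral>\<^sup>+\<theta>. ennreal c * (ennreal (f (a + cis \<theta> *s w)) * indicator {0..2*pi} \<theta>) \<partial>lborel)"
      by (rule nn_integral_cmult[symmetric]) measurable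
    also have "\<dots> = circle_nn (\<lambda>\<theta>. ennreal (c * f (a + cis \<theta> *s w)))"
      using c by (intro nn_integral_cong) (simp add: ennreal_mult' mult.assoc)
    finally show ?thesis .
  qed
  ultimately show ?thesis using assms c by (simp add: nonneg_psh_def)
qed

lemma nonneg_psh_sum:
  assumes "finite J" "\<And>j. j \<in> J \<Longrightarrow> nonneg_psh I (f j)"
  shows "nonneg_psh I (\<lambda>z. \<Sum>j\<in>J. f j z)"
  using assms by (induction J rule: finite_induct) (auto intro: nonneg_psh_const nonneg_psh_add)

lemma nonneg_psh_coord_proj:
  assumes "nonneg_psh I f"
  shows "nonneg_psh UNIV (\<lambda>z. f (coord_proj I z))"
proof -
  have usc: "real_usc (coord_space I) f" using assms by (simp add: nonneg_psh_def)
  have "coord_proj I ` coord_space UNIV \<subseteq> coord_space I"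
    using coord_proj_in by blast
  with usc have "real_usc (coord_space UNIV) (\<lambda>z. f (coord_proj I z))"
    by (rule real_usc_compose[OF _ continuous_on_coord_proj])
  moreover have "ennreal (2 * pi * f (coord_proj I a)) \<le>
      circle_nn (\<lambda>\<theta>. ennreal (f (coord_proj I (a + cis \<theta> *s w))))" for a w
    unfolding coord_proj_line using assms coord_proj_in[of I a] coord_proj_in[of I w]
    by (simp only: nonneg_psh_def)
  ultimately show ?thesis
    using assms unfolding nonneg_psh_def by blast
qed

text \<open>
  The submean inequality for \<open>u + k\<close> is transferred to its positive part by integrating
  \<open>u\<^sup>+ + k \<le> (u + k)\<^sup>+ + u\<^sup>-\<close> over the circle. Only the case \<open>f a > 0\<close> is of interest, and there
  \<open>u a > -\<infinity>\<close> forces the integral of \<open>u\<^sup>-\<close> to be finite.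
\<close>

lemma psh_positive_part:
  fixes u :: "complex ^ 'n::finite \<Rightarrow> ereal"
  assumes u: "psh I u" and k: "0 \<le> k"
    and f: "f = (\<lambda>z. if z \<in> coord_space I then pos_real (u z + ereal k) else 0)"
  shows "nonneg_psh I f"
proof -
  have f0: "0 \<le> f z" for z by (simp add: f real_of_ereal_pos)
  have fu: "ereal (f z) = max 0 (u z + ereal k)" if "z \<in> coord_space I" for z
  proof -
    have "u z < \<infinity>" using u that by (simp add: psh_def)
    then show ?thesis using that by (cases "u z") (auto simp: f max_def)
  qed
  have usc: "real_usc (coord_space I) f"
    unfolding real_usc_def
  proof
    fix c :: real
    have "{z \<in> coord_space I. f z < c} = (if 0 < c then {z \<in> coord_space I. u z < ereal (c - k)} else {})"
    proof -
      have "f z < c \<longleftrightarrow> 0 < c \<and> u z < ereal (c - k)" if "z \<in> coord_space I" for z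
      proof -
        have "f z < c \<longleftrightarrow> ereal (f z) < ereal c" by simp
        also have "\<dots> \<longleftrightarrow> 0 < c \<and> u z < ereal (c - k)"
          unfolding fu[OF that] by (cases "u z") auto
        finally show ?thesis .
      qed
      then show ?thesis by auto
    qed
    then show "openin (top_of_set (coord_space I)) {z \<in> coord_space I. f z < c}"
      using u by (auto simp: psh_def usc_on_def)
  qed
  have "ennreal (2 * pi * f a) \<le> circle_nn (\<lambda>\<theta>. ennreal (f (a + cis \<theta> *s w)))"
    if a: "a \<in> coord_space I" and w: "w \<in> coord_space I" for a w
  proof (cases "f a = 0 \<or> circle_nn (\<lambda>\<theta>. ennreal (f (a + cis \<theta> *s w))) = top")
    case True
    then show ?thesis by auto
  next
    case False
    define g where "g = (\<lambda>\<theta>. u (a + cis \<theta> *s w))"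
    define P where "P = circle_nn (\<lambda>\<theta>. e2ennreal (g \<theta>))"
    define N where "N = circle_nn (\<lambda>\<theta>. e2ennreal (- g \<theta>))"
    define Q where "Q = circle_nn (\<lambda>\<theta>. ennreal (f (a + cis \<theta> *s w)))"
    have circ: "a + cis \<theta> *s w \<in> coord_space I" for \<theta>
      using a w by (intro coord_space_add coord_space_vmult)
    have [measurable]: "g \<in> borel_measurable borel"
    proof (rule borel_measurableI_less)
      fix c
      have "openin (top_of_set UNIV) (UNIV \<inter> (\<lambda>\<theta>. a + cis \<theta> *s w) -` {z \<in> coord_space I. u z < c})"
        using u circ by (intro continuous_openin_preimage[of _ _ "coord_space I"] continuous_on_circle)
          (auto simp: psh_def usc_on_def)
      then show "{\<theta> \<in> space borel. g \<theta> < c} \<in> sets borel"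
        using circ by (simp add: g_def vimage_def)
    qed
    have fg: "ereal (f (a + cis \<theta> *s w)) = max 0 (g \<theta> + ereal k)" for \<theta>
      using fu[OF circ] by (simp add: g_def)
    have [measurable]: "(\<lambda>\<theta>. f (a + cis \<theta> *s w)) \<in> borel_measurable borel"
      using usc a w by (rule real_usc_circle_measurable)
    have le: "e2ennreal (g \<theta>) + ennreal k \<le> ennreal (f (a + cis \<theta> *s w)) + e2ennreal (- g \<theta>)" for \<theta>
    proof (cases "g \<theta>")
      case (real r)
      then have fr: "f (a + cis \<theta> *s w) = max 0 (r + k)"
        using fg[of \<theta>] by (simp add: ereal_max[symmetric] zero_ereal_def del: ereal_max)
      have "e2ennreal (g \<theta>) = ennreal (max 0 r)" "e2ennreal (- g \<theta>) = ennreal (max 0 (- r))"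
        using real by (simp_all add: max_def ennreal_neg)
      moreover have "max 0 r + k \<le> max 0 (r + k) + max 0 (- r)" by auto
      ultimately show ?thesis using k unfolding fr
        by (simp add: ennreal_plus[symmetric] ennreal_leI del: ennreal_plus)
    next
      case PInf
      then show ?thesis using fg[of \<theta>] by simp
    next
      case MInf
      then show ?thesis by (simp add: e2ennreal_neg)
    qed
    have PQ: "P + ennreal (2 * pi * k) \<le> Q + N"
    proof -
      have "P + ennreal (2 * pi * k) = circle_nn (\<lambda>\<theta>. e2ennreal (g \<theta>) + ennreal k)"
        using k by (subst circle_nn_add) (simp_all add: P_def circle_nn_const)
      also have "\<dots> \<le> circle_nn (\<lambda>\<theta>. ennreal (f (a + cis \<theta> *s w)) + e2ennreal (- g \<theta>))"
        by (rule circle_nn_mono[OF le])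
      also have "\<dots> = Q + N"
        unfolding Q_def N_def by (rule circle_nn_add) measurable
      finally show ?thesis .
    qed
    have PleQ: "P \<le> Q"
      unfolding P_def Q_def
    proof (rule circle_nn_mono)
      fix \<theta>
      have "g \<theta> \<le> ereal (f (a + cis \<theta> *s w))"
        unfolding fg using k by (cases "g \<theta>") (auto simp: le_max_iff_disj)
      then show "e2ennreal (g \<theta>) \<le> ennreal (f (a + cis \<theta> *s w))"
        using e2ennreal_mono by fastforce
    qed
    have "Q < top" using False by (simp add: Q_def less_top)
    then obtain q where q: "Q = ennreal q" "0 \<le> q" by (cases Q) auto
    obtain p where p: "P = ennreal p" "0 \<le> p" using PleQ \<open>Q < top\<close> by (cases P) (auto simp: top_unique)
    have mean: "u a \<le> ereal (1 / (2 * pi)) * (enn2ereal P - enn2ereal N)"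
      using u a w unfolding psh_def circle_mean_def P_def N_def g_def by blast
    have ua: "ereal (f a) = u a + ereal k" using False fu[OF a] by (auto simp: max_def split: if_splits)
    show ?thesis
    proof (cases N)
      case (real m)
      have "u a \<le> ereal ((p - m) / (2 * pi))"
        using mean p real by (simp add: field_simps)
      then have "f a \<le> (p - m) / (2 * pi) + k"
        using ua by (cases "u a") auto
      then have "2 * pi * f a \<le> p - m + 2 * pi * k"
        by (simp add: field_simps)
      also have "\<dots> \<le> q"
      proof -
        have "ennreal (p + 2 * pi * k) \<le> ennreal (q + m)"
          using PQ p q real k by simp
        then have "p + 2 * pi * k \<le> q + m"
          using q real by (subst (asm) ennreal_le_iff) auto
        then show ?thesis by simp
      qed
      finally show ?thesis using q by (simp add: Q_def[symmetric] ennreal_leI)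
    next
      case top
      then have "u a = -\<infinity>" using mean p by simp
      then show ?thesis using ua by simp
    qed
  qed
  then show ?thesis using f0 usc by (simp add: nonneg_psh_def)
qed

text \<open>
  Here the pointwise identity \<open>(f - k)\<^sup>+ + k = f + (f - k)\<^sup>-\<close> is integrated; the integral of the negative part
  is at most \<open>2 \<pi> k\<close>.
\<close>

lemma nonneg_psh_imp_psh_minus:
  fixes f :: "complex ^ 'n::finite \<Rightarrow> real"
  assumes f: "nonneg_psh I f" and k: "0 \<le> k"
  shows "psh I (\<lambda>z. ereal (f z - k))"
proof -
  have usc: "usc_on (coord_space I) (\<lambda>z. ereal (f z - k))"
    unfolding usc_on_def
  proof
    fix c
    show "openin (top_of_set (coord_space I)) {z \<in> coord_space I. ereal (f z - k) < c}"
    proof (cases c)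
      case (real r)
      then have "{z \<in> coord_space I. ereal (f z - k) < c} = {z \<in> coord_space I. f z < r + k}"
        by auto
      then show ?thesis using f by (simp add: nonneg_psh_def real_usc_def)
    qed auto
  qed
  have "ereal (f a - k) \<le> circle_mean (\<lambda>z. ereal (f z - k)) a w"
    if a: "a \<in> coord_space I" and w: "w \<in> coord_space I" for a w
  proof -
    define g where "g = (\<lambda>\<theta>. f (a + cis \<theta> *s w))"
    have [measurable]: "g \<in> borel_measurable borel"
      unfolding g_def using f a w by (auto simp: nonneg_psh_def intro: real_usc_circle_measurable)
    have g0: "0 \<le> g \<theta>" for \<theta> using f by (simp add: g_def nonneg_psh_def)
    define P where "P = circle_nn (\<lambda>\<theta>. ennreal (g \<theta> - k))"
    define N where "N = circle_nn (\<lambda>\<theta>. ennreal (k - g \<theta>))"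
    have mean: "circle_mean (\<lambda>z. ereal (f z - k)) a w = ereal (1 / (2 * pi)) * (enn2ereal P - enn2ereal N)"
      by (simp add: circle_mean_def P_def N_def g_def)
    have "P + ennreal (2 * pi * k) = circle_nn (\<lambda>\<theta>. ennreal (g \<theta> - k) + ennreal k)"
      using k by (subst circle_nn_add) (simp_all add: P_def circle_nn_const)
    also have "\<dots> = circle_nn (\<lambda>\<theta>. ennreal (g \<theta>) + ennreal (k - g \<theta>))"
    proof -
      have "ennreal (g \<theta> - k) + ennreal k = ennreal (g \<theta>) + ennreal (k - g \<theta>)" for \<theta>
        using k g0[of \<theta>] by (cases "k \<le> g \<theta>") (simp_all add: ennreal_neg flip: ennreal_plus)
      then show ?thesis by simp
    qed
    also have "\<dots> = circle_nn (\<lambda>\<theta>. ennreal (g \<theta>)) + N"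
      unfolding N_def by (rule circle_nn_add) measurable
    also have "\<dots> \<ge> ennreal (2 * pi * f a) + N"
      using f a w by (intro add_right_mono) (simp add: g_def nonneg_psh_def)
    finally have PN: "ennreal (2 * pi * f a) + N \<le> P + ennreal (2 * pi * k)" .
    have "N \<le> circle_nn (\<lambda>\<theta>. ennreal k)"
      unfolding N_def by (intro circle_nn_mono ennreal_leI) (simp add: g0)
    also have "\<dots> < top" using k by (simp add: circle_nn_const)
    finally obtain m where m: "N = ennreal m" "0 \<le> m" by (cases N) auto
    show ?thesis
    proof (cases P)
      case (real p)
      have "ennreal (2 * pi * f a + m) \<le> ennreal (p + 2 * pi * k)"
        using PN real m k f by (simp add: nonneg_psh_def)
      then have "2 * pi * f a + m \<le> p + 2 * pi * k"
        using real k by (subst (asm) ennreal_le_iff) auto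
      then have "f a - k \<le> (p - m) / (2 * pi)" by (simp add: field_simps)
      then show ?thesis unfolding mean using real m by (simp add: field_simps)
    next
      case top
      then show ?thesis unfolding mean using m by simp
    qed
  qed
  then show ?thesis using usc by (simp add: psh_def)
qed

lemma nonneg_psh_mean_continuous:
  assumes f: "nonneg_psh I f" and aw: "a \<in> coord_space I" "w \<in> coord_space I"
    and h: "continuous_on {0..2*pi} h" "\<And>\<theta>. f (a + cis \<theta> *s w) \<le> h \<theta>"
  shows "2 * pi * f a \<le> integral {0..2*pi} h"
proof -
  have h0: "0 \<le> h \<theta>" for \<theta>
    using f h(2)[of \<theta>] by (meson nonneg_psh_def order.trans)
  have "ennreal (2 * pi * f a) \<le> circle_nn (\<lambda>\<theta>. ennreal (f (a + cis \<theta> *s w)))"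
    using f aw by (simp add: nonneg_psh_def)
  also have "\<dots> \<le> circle_nn (\<lambda>\<theta>. ennreal (h \<theta>))"
    by (intro circle_nn_mono ennreal_leI h)
  also have "\<dots> = ennreal (integral {0..2*pi} h)"
    using h(1) h0 by (rule circle_nn_continuous)
  finally show ?thesis
    using h0 h(1) by (subst (asm) ennreal_le_iff) (auto intro!: integral_nonneg integrable_continuous_real)
qed

section \<open>Logarithms of monomials and logarithmic supporting functions\<close>

text \<open>
  The function \<open>max(0, \<Sum>\<^sub>i s\<^sub>i log |z\<^sub>i|)\<close>, written through the monomial so that it is visibly continuous where
  coordinates vanish. Only positive exponents enter the product, as \<open>0 powr 0 = 0\<close>.
\<close>

definition log_monomial :: "real ^ 'n::finite \<Rightarrow> complex ^ 'n \<Rightarrow> real" where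
  "log_monomial s z = ln (max 1 (\<Prod>i\<in>{i. 0 < s $ i}. cmod (z $ i) powr (s $ i)))"

lemma log_monomial_nonneg: "0 \<le> log_monomial s z"
  by (simp add: log_monomial_def)

lemma log_monomial_nonzero:
  assumes "\<And>i. 0 \<le> s $ i" "\<And>i. 0 < s $ i \<Longrightarrow> z $ i \<noteq> 0"
  shows "log_monomial s z = max 0 (\<Sum>i\<in>UNIV. s $ i * ln (cmod (z $ i)))"
proof -
  let ?P = "\<Prod>i\<in>{i. 0 < s $ i}. cmod (z $ i) powr (s $ i)"
  have pos: "0 < ?P" using assms by (intro prod_pos) auto
  have "ln ?P = (\<Sum>i\<in>{i. 0 < s $ i}. ln (cmod (z $ i) powr (s $ i)))"
    using assms by (intro ln_prod) auto
  also have "\<dots> = (\<Sum>i\<in>{i. 0 < s $ i}. s $ i * ln (cmod (z $ i)))"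
    using assms by (intro sum.cong) (auto simp: ln_powr)
  also have "\<dots> = (\<Sum>i\<in>UNIV. s $ i * ln (cmod (z $ i)))"
    using assms(1) by (intro sum.mono_neutral_left) (auto simp: not_less intro: antisym)
  finally have ln: "ln ?P = (\<Sum>i\<in>UNIV. s $ i * ln (cmod (z $ i)))" .
  show ?thesis
  proof (cases "1 \<le> ?P")
    case True
    then have "0 \<le> ln ?P" by (rule ln_ge_zero)
    then show ?thesis using True unfolding log_monomial_def ln[symmetric] by (simp only: max_absorb2)
  next
    case False
    then have "ln ?P \<le> 0" using pos by simp
    then show ?thesis using False unfolding log_monomial_def ln[symmetric] by (simp only: max_absorb1 not_le less_imp_le ln_one)
  qed
qed

lemma log_monomial_zero:
  assumes "0 < s $ i" "z $ i = 0"
  shows "log_monomial s z = 0"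
proof -
  have "(\<Prod>i\<in>{i. 0 < s $ i}. cmod (z $ i) powr (s $ i)) = 0"
    using assms by (intro prod_zero) auto
  then show ?thesis unfolding log_monomial_def by (simp only: max_def) simp
qed

lemma continuous_on_log_monomial:
  assumes "continuous_on X g"
  shows "continuous_on X (\<lambda>x. log_monomial s (g x))"
proof -
  have "max 1 p \<noteq> 0" for p :: real by (auto simp: max_def)
  then show ?thesis
    unfolding log_monomial_def
    by (intro continuous_on_ln continuous_on_max continuous_on_const continuous_on_prod
        continuous_on_powr' continuous_on_norm continuous_intros assms) auto
qed

text \<open>
  At a point where the function is positive, the coordinates \<open>a\<^sub>i\<close> with \<open>s\<^sub>i > 0\<close> are nonzero, and the submean
  inequality is the sum of the Jensen inequalities for the \<open>a\<^sub>i + w\<^sub>i cis \<theta>\<close>, provided that none of these vanishes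
  on the circle. This can fail, but after scaling \<open>w\<close> by \<open>\<rho>\<close> it fails for finitely many \<open>\<rho>\<close> only, and the
  circle mean of a continuous function depends continuously on \<open>\<rho>\<close>.
\<close>

lemma nonneg_psh_log_monomial:
  fixes s :: "real ^ 'n::finite"
  assumes s: "\<And>i. 0 \<le> s $ i"
  shows "nonneg_psh I (log_monomial s)"
proof -
  have mean: "2 * pi * log_monomial s a \<le> integral {0..2*pi} (\<lambda>\<theta>. log_monomial s (a + cis \<theta> *s w))"
    if pos: "0 < log_monomial s a" for a w
  proof -
    define \<Phi> where "\<Phi> = (\<lambda>\<rho>::real. integral (cbox 0 (2*pi)) (\<lambda>\<theta>. log_monomial s (a + (of_real \<rho> * cis \<theta>) *s w)))"
    have nz: "a $ i \<noteq> 0" if "0 < s $ i" for i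
      using pos log_monomial_zero[OF that] by fastforce
    have cont: "continuous_on UNIV \<Phi>"
      unfolding \<Phi>_def
    proof (rule integral_continuous_on_param)
      have "continuous_on (UNIV \<times> cbox 0 (2*pi)) (\<lambda>x. a + (complex_of_real (fst x) * cis (snd x)) *s w)"
        by (rule continuous_on_compose2[OF continuous_on_line[of UNIV]]) (auto intro!: continuous_intros)
      then show "continuous_on (UNIV \<times> cbox 0 (2*pi)) (\<lambda>(\<rho>, \<theta>). log_monomial s (a + (complex_of_real \<rho> * cis \<theta>) *s w))"
        using continuous_on_log_monomial by (fastforce simp: case_prod_unfold)
    qed
    \<comment> \<open>The radii at which some coordinate may vanish on the circle; a vanishing \<open>w $ i\<close> contributes
      \<open>0\<close> by the convention for division, which is not a positive radius.\<close>
    define Bad where "Bad = (\<lambda>i. cmod (a $ i) / cmod (w $ i)) ` UNIV"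
    have good: "2 * pi * log_monomial s a \<le> \<Phi> \<rho>" if \<rho>: "0 < \<rho>" "\<rho> \<notin> Bad" for \<rho>
    proof -
      have ne: "cmod (of_real \<rho> * w $ i) \<noteq> cmod (a $ i)" if "0 < s $ i" for i
      proof
        assume eq: "cmod (of_real \<rho> * w $ i) = cmod (a $ i)"
        then have "w $ i \<noteq> 0" using nz[OF that] by auto
        then have "\<rho> = cmod (a $ i) / cmod (w $ i)" using eq \<rho> by (simp add: norm_mult field_simps)
        then show False using \<rho> by (auto simp: Bad_def)
      qed
      have "\<exists>m. 2 * pi * ln (cmod (a $ i)) \<le> m \<and>
          ((\<lambda>\<theta>. ln (cmod (a $ i + (of_real \<rho> * w $ i) * cis \<theta>))) has_integral m) {0..2*pi}" if "0 < s $ i" for i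
        using mean_ln_cmod_circle_ge[OF nz[OF that] ne[OF that]] by auto
      then obtain m where m: "\<And>i. 0 < s $ i \<Longrightarrow> 2 * pi * ln (cmod (a $ i)) \<le> m i"
         "\<And>i. 0 < s $ i \<Longrightarrow> ((\<lambda>\<theta>. ln (cmod (a $ i + (of_real \<rho> * w $ i) * cis \<theta>))) has_integral m i) {0..2*pi}"
        by metis
      let ?J = "{i. 0 < s $ i}"
      have sumJ: "(\<Sum>i\<in>UNIV. s $ i * ln (cmod (z $ i))) = (\<Sum>i\<in>?J. s $ i * ln (cmod (z $ i)))" for z :: "complex ^ 'n"
        using s by (intro sum.mono_neutral_right) (auto simp: not_less intro: antisym)
      have int: "((\<lambda>\<theta>. \<Sum>i\<in>?J. s $ i * ln (cmod (a $ i + (of_real \<rho> * w $ i) * cis \<theta>)))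
          has_integral (\<Sum>i\<in>?J. s $ i * m i)) {0..2*pi}"
        using m(2) by (intro has_integral_sum has_integral_mult_right) auto
      have "2 * pi * log_monomial s a = 2 * pi * (\<Sum>i\<in>?J. s $ i * ln (cmod (a $ i)))"
        using pos log_monomial_nonzero[OF s nz] sumJ[of a] by (auto simp: max_def split: if_splits)
      also have "\<dots> = (\<Sum>i\<in>?J. s $ i * (2 * pi * ln (cmod (a $ i))))"
        by (simp add: sum_distrib_left mult_ac)
      also have "\<dots> \<le> (\<Sum>i\<in>?J. s $ i * m i)"
        using m(1) s by (intro sum_mono mult_left_mono) auto
      also have "\<dots> \<le> \<Phi> \<rho>"
        unfolding \<Phi>_def cbox_interval
      proof (rule has_integral_le[OF int])
        show "((\<lambda>\<theta>. log_monomial s (a + (of_real \<rho> * cis \<theta>) *s w)) has_integral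
            integral {0..2*pi} (\<lambda>\<theta>. log_monomial s (a + (of_real \<rho> * cis \<theta>) *s w))) {0..2*pi}"
          by (intro integrable_integral integrable_continuous_real continuous_on_log_monomial
                continuous_on_compose2[OF continuous_on_line[of UNIV]]) (auto intro!: continuous_intros)
        fix \<theta> :: real
        let ?z = "a + (of_real \<rho> * cis \<theta>) *s w"
        have "?z $ i \<noteq> 0" if "0 < s $ i" for i
        proof
          assume "?z $ i = 0"
          then have "a $ i = - (of_real \<rho> * cis \<theta> * w $ i)" by (simp add: add_eq_0_iff2)
          then have "cmod (a $ i) = cmod (of_real \<rho> * w $ i)" by (simp add: norm_mult)
          with ne[OF that] show False by simp
        qed
        then have "(\<Sum>i\<in>UNIV. s $ i * ln (cmod (?z $ i))) \<le> log_monomial s ?z"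
          using log_monomial_nonzero[OF s, of ?z] by simp
        then show "(\<Sum>i\<in>?J. s $ i * ln (cmod (a $ i + (of_real \<rho> * w $ i) * cis \<theta>))) \<le> log_monomial s ?z"
          unfolding sumJ by (simp add: mult_ac)
      qed
      finally show ?thesis .
    qed
    have fin: "finite (Bad \<union> {1})" by (simp add: Bad_def)
    have "\<forall>\<^sub>F \<rho> in at 1. \<rho> \<in> - (Bad - {1}) \<and> \<rho> \<in> {0<..} \<and> \<rho> \<noteq> 1"
    proof (intro eventually_conj)
      show "\<forall>\<^sub>F \<rho> in at (1::real). \<rho> \<in> - (Bad - {1})"
        using fin by (intro eventually_at_in_open' open_Compl finite_imp_closed) auto
      show "\<forall>\<^sub>F \<rho> in at (1::real). \<rho> \<in> {0<..}"
        by (intro eventually_at_in_open') auto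
      show "\<forall>\<^sub>F \<rho> in at (1::real). \<rho> \<noteq> 1"
        by (simp add: eventually_at_filter)
    qed
    then have ev: "\<forall>\<^sub>F \<rho> in at 1. 2 * pi * log_monomial s a \<le> \<Phi> \<rho>"
      by (rule eventually_mono) (auto intro: good)
    have "(\<Phi> \<longlongrightarrow> \<Phi> 1) (at 1)"
      using cont by (simp add: continuous_on_def)
    then have "2 * pi * log_monomial s a \<le> \<Phi> 1"
      using ev by (rule tendsto_lowerbound) simp
    then show ?thesis by (simp add: \<Phi>_def)
  qed
  have "ennreal (2 * pi * log_monomial s a) \<le> circle_nn (\<lambda>\<theta>. ennreal (log_monomial s (a + cis \<theta> *s w)))" for a w
  proof (cases "log_monomial s a = 0")
    case False
    then have "0 < log_monomial s a" using log_monomial_nonneg[of s a] by simp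
    moreover have "circle_nn (\<lambda>\<theta>. ennreal (log_monomial s (a + cis \<theta> *s w))) =
        ennreal (integral {0..2*pi} (\<lambda>\<theta>. log_monomial s (a + cis \<theta> *s w)))"
      by (intro circle_nn_continuous continuous_on_log_monomial continuous_on_circle log_monomial_nonneg)
    ultimately show ?thesis using mean[of a w] by (simp add: ennreal_leI)
  qed simp
  then show ?thesis
    by (simp add: nonneg_psh_def log_monomial_nonneg real_usc_continuous continuous_on_log_monomial)
qed

lemma log_supp_torus_eq:
  "log_supp_torus S z = (SUP s\<in>S. ereal (\<Sum>i\<in>UNIV. s $ i * ln (cmod (z $ i))))"
  by (simp add: log_supp_torus_def supp_fun_def)

lemma log_supp_torus_upper: "s \<in> S \<Longrightarrow> ereal (\<Sum>i\<in>UNIV. s $ i * ln (cmod (z $ i))) \<le> log_supp_torus S z"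
  unfolding log_supp_torus_eq by (rule SUP_upper)

lemma log_supp_torus_nonneg: "0 \<in> S \<Longrightarrow> 0 \<le> log_supp_torus S z"
  using log_supp_torus_upper[of 0 S z] by (simp add: zero_ereal_def)

lemma coord_torus_dense:
  fixes z :: "complex ^ 'n::finite"
  assumes "z \<in> coord_space I" "0 < e"
  shows "\<exists>w\<in>coord_torus I. dist w z < e \<and> (z \<in> coord_torus I \<longrightarrow> w = z)"
proof -
  define t where "t = e / (2 * real CARD('n))"
  have t: "0 < t" using assms by (simp add: t_def)
  define w where "w = (\<chi> i. if i \<in> I \<and> z $ i = 0 then of_real t else z $ i)"
  have "w \<in> coord_torus I"
    using assms t by (auto simp: coord_torus_def coord_space_def w_def)
  moreover have "dist w z < e"
  proof -
    have "norm (w - z) \<le> (\<Sum>i\<in>UNIV. norm ((w - z) $ i))" 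
      unfolding norm_vec_def by (rule L2_set_le_sum) simp
    also have "\<dots> \<le> (\<Sum>i\<in>(UNIV::'n set). t)" using t by (intro sum_mono) (simp add: w_def)
    also have "\<dots> = e / 2" by (simp add: t_def)
    also have "\<dots> < e" using assms by simp
    finally show ?thesis by (simp add: dist_norm)
  qed
  moreover have "w = z" if "z \<in> coord_torus I"
    using that by (auto simp: w_def coord_torus_def vec_eq_iff)
  ultimately show ?thesis by blast
qed

text \<open>
  A formulation of the upper limit by nearby points of the torus, which can be chosen block by block in a
  product; \<open>log_supp_ge\<close> is its converse. At points of the torus no passage to a limit takes place, hence the
  clause \<open>w = z\<close>.
\<close>

lemma log_supp_approx:
  fixes z :: "complex ^ 'n::finite"
  assumes z: "z \<in> coord_space I" and S0: "0 \<in> S" and r: "ereal r < log_supp I S z \<or> r < 0" and e: "0 < e"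
  shows "\<exists>w\<in>coord_torus I. dist w z < e \<and> (z \<in> coord_torus I \<longrightarrow> w = z) \<and> ereal r < log_supp_torus S w"
proof (cases "r < 0")
  case True
  then have "ereal r < log_supp_torus S w" for w
    using log_supp_torus_nonneg[OF S0, of w] less_le_trans[of "ereal r" 0 "log_supp_torus S w"] by simp
  then show ?thesis using coord_torus_dense[OF z e] by blast
next
  case False
  then have r: "ereal r < log_supp I S z" using r by simp
  show ?thesis
  proof (cases "z \<in> coord_torus I")
    case True
    then show ?thesis using r e by (intro bexI[of _ z]) (auto simp: log_supp_def)
  next
    case False
    show ?thesis
    proof (rule ccontr)
      assume "\<not> ?thesis"
      then have "\<forall>w\<in>coord_torus I. dist w z < e \<longrightarrow> log_supp_torus S w \<le> ereal r"
        using False by (auto simp: not_less)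
      then have "Limsup (at z within coord_torus I) (log_supp_torus S) \<le> ereal r"
        using e by (intro Limsup_bounded) (auto simp: eventually_at)
      then show False using r False by (simp add: log_supp_def)
    qed
  qed
qed

lemma log_supp_ge:
  fixes z :: "complex ^ 'n::finite"
  assumes "\<And>e. 0 < e \<Longrightarrow>
    \<exists>w\<in>coord_torus I. dist w z < e \<and> (z \<in> coord_torus I \<longrightarrow> w = z) \<and> r \<le> log_supp_torus S w"
  shows "r \<le> log_supp I S z"
proof (cases "z \<in> coord_torus I")
  case True
  then show ?thesis using assms[of 1] by (auto simp: log_supp_def)
next
  case False
  show ?thesis
  proof (rule ccontr)
    assume "\<not> ?thesis"
    then have "\<forall>\<^sub>F w in at z within coord_torus I. log_supp_torus S w < r"
      using False by (intro Limsup_lessD) (simp add: log_supp_def)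
    then obtain e where e: "0 < e" "\<forall>w\<in>coord_torus I. w \<noteq> z \<and> dist w z < e \<longrightarrow> log_supp_torus S w < r"
      by (auto simp: eventually_at)
    then show False using assms[OF e(1)] False by (metis not_le)
  qed
qed

lemma log_supp_nonneg: "z \<in> coord_space I \<Longrightarrow> 0 \<in> S \<Longrightarrow> 0 \<le> log_supp I S z"
  for z :: "complex ^ 'n::finite"
  using coord_torus_dense log_supp_torus_nonneg by (intro log_supp_ge) blast

lemma log_monomial_le_log_supp:
  fixes z :: "complex ^ 'n::finite"
  assumes S: "S \<subseteq> nonneg_orthant I" "0 \<in> S" "s \<in> S" and z: "z \<in> coord_space I"
  shows "ereal (log_monomial s z) \<le> log_supp I S z + ereal 1"
proof -
  have s: "\<And>i. 0 \<le> s $ i" "\<And>i. i \<notin> I \<Longrightarrow> s $ i = 0"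
    using S by (auto simp: nonneg_orthant_def coord_space_def)
  have "ereal (log_monomial s z - 1) \<le> log_supp I S z"
  proof (rule log_supp_ge)
    fix e :: real assume e: "0 < e"
    have "isCont (log_monomial s) z"
      using continuous_on_log_monomial[of UNIV "\<lambda>x. x" s] by (simp add: continuous_on_eq_continuous_at)
    then obtain d where d: "0 < d" "\<And>w. dist w z < d \<Longrightarrow> dist (log_monomial s w) (log_monomial s z) < 1"
      by (auto simp: continuous_at_eps_delta) (meson zero_less_one)
    obtain w where w: "w \<in> coord_torus I" "dist w z < min d e" "z \<in> coord_torus I \<longrightarrow> w = z"
      using coord_torus_dense[OF z, of "min d e"] d e by auto
    have "log_monomial s w = max 0 (\<Sum>i\<in>UNIV. s $ i * ln (cmod (w $ i)))"
      using s w(1) by (intro log_monomial_nonzero) (auto simp: coord_torus_def)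
    then have "ereal (log_monomial s w) \<le> log_supp_torus S w"
      using log_supp_torus_upper[OF S(3), of w] log_supp_torus_nonneg[OF S(2), of w]
      by (auto simp: max_def zero_ereal_def)
    moreover have "log_monomial s z - 1 \<le> log_monomial s w"
      using d(2)[of w] w by (auto simp: dist_real_def)
    ultimately have "ereal (log_monomial s z - 1) \<le> log_supp_torus S w"
      by (meson ereal_less_eq(3) order_trans)
    then show "\<exists>w\<in>coord_torus I. dist w z < e \<and> (z \<in> coord_torus I \<longrightarrow> w = z) \<and>
        ereal (log_monomial s z - 1) \<le> log_supp_torus S w"
      using w by auto
  qed
  then have "ereal (log_monomial s z - 1) + ereal 1 \<le> log_supp I S z + ereal 1"
    by (rule add_right_mono)
  then show ?thesis by simp
qed

section \<open>Extremal functions and their growth along a line\<close>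

text \<open>
  The nonnegative candidates for the unweighted extremal function; being nonnegative, they vanish on \<open>K\<close>.
\<close>

definition competitor ::
    "'n set \<Rightarrow> (real ^ 'n::finite) set \<Rightarrow> (complex ^ 'n) set \<Rightarrow> (complex ^ 'n \<Rightarrow> real) \<Rightarrow> bool" where
  "competitor I S K f \<longleftrightarrow> nonneg_psh I f \<and>
    (\<exists>c::real. \<forall>z\<in>coord_space I. ereal (f z) \<le> log_supp I S z + ereal c) \<and> (\<forall>w\<in>K. f w = 0)"

lemma competitor_minus_const_le:
  assumes f: "nonneg_psh I f" "\<forall>z\<in>coord_space I. ereal (f z) \<le> log_supp I S z + ereal c"
    and k: "0 \<le> k" "\<forall>w\<in>K. ereal (f w - k) \<le> q w"
  shows "ereal (f z - k) \<le> siciak_zakharyuta I S K q z"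
proof -
  have "ereal (f z - k) \<le> log_supp I S z + ereal c" if "z \<in> coord_space I" for z
  proof -
    have "ereal (f z - k) \<le> ereal (f z)" using k by simp
    also have "\<dots> \<le> log_supp I S z + ereal c" using f(2) that by simp
    finally show ?thesis .
  qed
  then have "(\<lambda>z. ereal (f z - k)) \<in> lelong_class I S"
    using nonneg_psh_imp_psh_minus[OF f(1) k(1)] by (auto simp: lelong_class_def)
  then show ?thesis
    unfolding siciak_zakharyuta_def using k(2) by (intro SUP_upper2[of "\<lambda>z. ereal (f z - k)"]) auto
qed

lemma competitor_le:
  assumes "competitor I S K f"
  shows "ereal (f z) \<le> siciak_zakharyuta I S K (\<lambda>_. 0) z"
  using assms competitor_minus_const_le[of I f S _ 0 K "\<lambda>_. 0" z] by (auto simp: competitor_def zero_ereal_def)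

text \<open>
  Replacing \<open>u\<close> by the positive part of \<open>u + k\<close> does not leave the Lelong class, because \<open>log_supp\<close> is
  nonnegative when \<open>0 \<in> S\<close>.
\<close>

lemma competitor_of_lelong:
  assumes u: "u \<in> lelong_class I S" and k: "0 \<le> k" "\<forall>w\<in>K. u w \<le> ereal (- k)"
    and K: "K \<subseteq> coord_space I" and S0: "0 \<in> S"
  shows "\<exists>f. competitor I S K f \<and> (\<forall>z\<in>coord_space I. ereal (f z) = max 0 (u z + ereal k))"
proof -
  define f where "f = (\<lambda>z. if z \<in> coord_space I then pos_real (u z + ereal k) else 0)"
  have psh: "psh I u" using u by (simp add: lelong_class_def)
  obtain c where c: "\<And>z. z \<in> coord_space I \<Longrightarrow> u z \<le> log_supp I S z + ereal c"
    using u by (auto simp: lelong_class_def)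
  have fu: "ereal (f z) = max 0 (u z + ereal k)" if "z \<in> coord_space I" for z
  proof -
    have "u z < \<infinity>" using psh that by (simp add: psh_def)
    then show ?thesis using that by (cases "u z") (auto simp: f_def max_def)
  qed
  define d where "d = max 0 c"
  have d: "c \<le> d" "0 \<le> d" by (auto simp: d_def)
  have "ereal (f z) \<le> log_supp I S z + ereal (d + k)" if z: "z \<in> coord_space I" for z
  proof -
    have "u z + ereal k \<le> (log_supp I S z + ereal (d)) + ereal k"
      using c[OF z] by (intro add_right_mono order_trans[OF c[OF z]] add_left_mono) (simp add: d)
    moreover have "0 \<le> (log_supp I S z + ereal (d)) + ereal k"
      using log_supp_nonneg[OF z S0] k(1) d by (intro add_nonneg_nonneg) auto
    moreover have "(log_supp I S z + ereal (d)) + ereal k = log_supp I S z + ereal (d + k)"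
      by (simp add: add.assoc)
    ultimately show ?thesis unfolding fu[OF z] by simp
  qed
  moreover have "f w = 0" if "w \<in> K" for w
  proof -
    have "u w + ereal k \<le> ereal (- k) + ereal k"
      using k that by (intro add_right_mono) auto
    then have "ereal (f w) = 0" using fu[of w] K that by (auto simp: max_def zero_ereal_def)
    then show ?thesis by simp
  qed
  moreover have "nonneg_psh I f" using psh k(1) f_def by (rule psh_positive_part)
  ultimately have "competitor I S K f" unfolding competitor_def by blast
  then show ?thesis using fu by blast
qed

lemma siciak_competitor_approx:
  assumes "r < siciak_zakharyuta I S K (\<lambda>_. 0) z"
    and "K \<subseteq> coord_space I" "0 \<in> S" "z \<in> coord_space I"
  shows "\<exists>f. competitor I S K f \<and> r < ereal (f z)"
proof -
  obtain u where u: "u \<in> lelong_class I S" "\<forall>w\<in>K. u w \<le> 0" "r < u z"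
    using assms(1) unfolding siciak_zakharyuta_def by (auto simp: less_SUP_iff)
  obtain f where f: "competitor I S K f" "ereal (f z) = max 0 (u z + ereal 0)"
    using competitor_of_lelong[OF u(1) order_refl, of K] u(2) assms(2-4) by (auto simp: zero_ereal_def)
  have "u z \<le> ereal (f z)" using f(2) by simp
  then show ?thesis using f(1) u(3) by (auto intro: less_le_trans)
qed

lemma siciak_shift_le:
  assumes c: "c \<le> 0" and K: "K \<subseteq> coord_space I" and S0: "0 \<in> S" and z: "z \<in> coord_space I"
  shows "siciak_zakharyuta I S K (\<lambda>_. ereal c) z \<le> siciak_zakharyuta I S K (\<lambda>_. 0) z + ereal c"
  unfolding siciak_zakharyuta_def[of I S K "\<lambda>_. ereal c"]
proof (rule SUP_least)
  fix u assume u: "u \<in> {u \<in> lelong_class I S. \<forall>w\<in>K. u w \<le> ereal c}"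
  then obtain f where f: "competitor I S K f" "ereal (f z) = max 0 (u z + ereal (- c))"
    using competitor_of_lelong[of u I S "- c" K] c K S0 z by auto
  have "u z + ereal (- c) \<le> siciak_zakharyuta I S K (\<lambda>_. 0) z"
    using competitor_le[OF f(1), of z] f(2) by simp
  then have "(u z + ereal (- c)) + ereal c \<le> siciak_zakharyuta I S K (\<lambda>_. 0) z + ereal c"
    by (rule add_right_mono)
  then show "u z \<le> siciak_zakharyuta I S K (\<lambda>_. 0) z + ereal c"
    by (cases "u z") auto
qed

lemma siciak_ge_log_monomial:
  fixes S :: "(real ^ 'n::finite) set"
  assumes S: "S \<subseteq> nonneg_orthant I" "0 \<in> S" "s \<in> S" and K: "compact K"
  shows "\<exists>C\<ge>0. \<forall>z. ereal (log_monomial s z - C) \<le> siciak_zakharyuta I S K (\<lambda>_. 0) z"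
proof -
  have s: "\<And>i. 0 \<le> s $ i" using S by (auto simp: nonneg_orthant_def)
  have "continuous_on K (log_monomial s)"
    using continuous_on_log_monomial[of K "\<lambda>x. x" s] by simp
  then have "bounded (log_monomial s ` K)"
    using K compact_continuous_image compact_imp_bounded by blast
  then obtain C where C: "\<And>w. w \<in> K \<Longrightarrow> log_monomial s w \<le> C"
    unfolding bounded_iff by (metis image_eqI real_norm_def abs_le_D1)
  have "ereal (log_monomial s z - max 0 C) \<le> siciak_zakharyuta I S K (\<lambda>_. 0) z" for z
    using C log_monomial_le_log_supp[OF S]
    by (intro competitor_minus_const_le[OF nonneg_psh_log_monomial[OF s], of _ _ 1])
       (auto simp: zero_ereal_def intro: max.coboundedI2)
  then show ?thesis by (intro exI[of _ "max 0 C"]) auto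
qed

lemma norm_vmult: "norm (c *s w) = cmod c * norm w" for w :: "complex ^ 'n::finite"
  by (simp add: norm_vec_def L2_set_def norm_mult power_mult_distrib real_sqrt_mult
      flip: sum_distrib_left)

text \<open>
  On the line \<open>a + \<zeta> w\<close> through a point of \<open>K\<close>, with \<open>w\<close> the all-ones vector of \<open>coord_space I\<close>, the extremal
  function is \<open>\<sigma> log |\<zeta>| + O(1)\<close>, so it takes every value \<open>t \<ge> 0\<close> up to a bounded error. For large \<open>|\<zeta>|\<close> every
  coordinate with index in \<open>I\<close> has modulus between \<open>|\<zeta>| / 2\<close> and \<open>2 |\<zeta>|\<close>; hence the supporting function grows like
  \<open>\<sigma> log |\<zeta>|\<close>, and so does the logarithm of the monomial with a maximizing exponent. The candidates may
  exceed the supporting function by constants that are not bounded uniformly; the maximum principle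
  replaces these by the uniform bound near \<open>a\<close>.
\<close>

lemma siciak_line_growth:
  fixes S :: "(real ^ 'n::finite) set" and K :: "(complex ^ 'n) set"
  assumes S: "S \<subseteq> nonneg_orthant I" "compact S" "0 \<in> S" "S \<noteq> {0}"
    and K: "K \<subseteq> coord_space I" "compact K" and a: "a \<in> K"
    and V0: "usc_reg (coord_space I) (siciak_zakharyuta I S K (\<lambda>_. 0)) a = 0"
  shows "\<exists>B. \<forall>t\<ge>0. \<exists>z\<in>coord_space I. \<exists>A.
    siciak_zakharyuta I S K (\<lambda>_. 0) z = ereal A \<and> \<bar>A - t\<bar> \<le> B"
proof -
  let ?V = "siciak_zakharyuta I S K (\<lambda>_. 0)"
  have orth: "0 \<le> s $ i" "i \<notin> I \<Longrightarrow> s $ i = 0" if "s \<in> S" for s i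
    using S(1) that by (auto simp: nonneg_orthant_def coord_space_def)
  have aI: "a \<in> coord_space I" using K a by auto
  \<comment> \<open>A maximizing exponent; its coordinate sum is the slope of the extremal function along the line.\<close>
  obtain s where s: "s \<in> S" "\<And>s'. s' \<in> S \<Longrightarrow> (\<Sum>i\<in>UNIV. s' $ i) \<le> (\<Sum>i\<in>UNIV. s $ i)"
  proof -
    have "continuous_on S (\<lambda>s. \<Sum>i\<in>UNIV. s $ i)" by (intro continuous_intros)
    then show ?thesis
      using continuous_attains_sup[OF S(2), of "\<lambda>s. \<Sum>i\<in>UNIV. s $ i"] S(3) that by blast
  qed
  define \<sigma> where "\<sigma> = (\<Sum>i\<in>UNIV. s $ i)"
  have \<sigma>: "0 < \<sigma>"
  proof -
    obtain s' where s': "s' \<in> S" "s' \<noteq> 0" using S by blast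
    then obtain i where i: "s' $ i \<noteq> 0" by (auto simp: vec_eq_iff)
    have "0 < (\<Sum>i\<in>UNIV. s' $ i)"
      using i orth(1)[OF s'(1)] by (intro sum_pos2[of _ i]) (auto simp: less_le)
    then show ?thesis using s(2)[OF s'(1)] by (simp add: \<sigma>_def)
  qed
  define w :: "complex ^ 'n" where "w = (\<chi> i. if i \<in> I then 1 else 0)"
  define p where "p = (\<lambda>\<zeta>. a + \<zeta> *s w)"
  have wI: "w \<in> coord_space I" by (simp add: w_def coord_space_def)
  have pI: "p \<zeta> \<in> coord_space I" for \<zeta>
    unfolding p_def by (intro coord_space_add coord_space_vmult aI wI)
  have p_nth: "p \<zeta> $ i = a $ i + \<zeta>" if "i \<in> I" for \<zeta> i
    using that by (simp add: p_def w_def)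
  define R where "R = 2 * norm a + 2"
  have p_bounds: "cmod \<zeta> / 2 \<le> cmod (p \<zeta> $ i)" "cmod (p \<zeta> $ i) \<le> 2 * cmod \<zeta>" "1 \<le> cmod \<zeta> / 2"
    if "i \<in> I" "R \<le> cmod \<zeta>" for \<zeta> i
  proof -
    have "cmod (a $ i) \<le> norm a" by (rule Finite_Cartesian_Product.norm_nth_le)
    then show "cmod \<zeta> / 2 \<le> cmod (p \<zeta> $ i)" "cmod (p \<zeta> $ i) \<le> 2 * cmod \<zeta>" "1 \<le> cmod \<zeta> / 2"
      using that norm_triangle_ineq[of "a $ i" \<zeta>] norm_diff_ineq[of \<zeta> "a $ i"] norm_ge_zero[of a]
      unfolding p_nth[OF that(1)] by (auto simp: R_def add.commute)
  qed
  have R0: "0 < R" "2 \<le> R" by (simp_all add: R_def add_nonneg_pos)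
  obtain \<delta>0 where \<delta>0: "0 < \<delta>0" "\<And>z. z \<in> coord_space I \<Longrightarrow> dist z a < \<delta>0 \<Longrightarrow> ?V z < 1"
  proof -
    have "\<forall>\<^sub>F z in inf (nhds a) (principal (coord_space I)). ?V z < 1"
      using V0 unfolding usc_reg_def by (intro Limsup_lessD) simp
    then have "\<forall>\<^sub>F z in nhds a. z \<in> coord_space I \<longrightarrow> ?V z < 1"
      by (simp add: eventually_inf_principal)
    then show ?thesis using that by (auto simp: eventually_nhds_metric)
  qed
  define \<delta> where "\<delta> = \<delta>0 / (norm w + 1)"
  have nw: "0 < norm w + 1" using norm_ge_zero[of w] by linarith
  have \<delta>: "0 < \<delta>" using \<delta>0 nw by (simp add: \<delta>_def)
  have near: "dist (p \<zeta>) a < \<delta>0" if "cmod \<zeta> = \<delta>" for \<zeta>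
  proof -
    have "dist (p \<zeta>) a = \<delta> * norm w" using that by (simp add: p_def dist_norm norm_vmult)
    also have "\<dots> < \<delta> * (norm w + 1)" using \<delta> by simp
    also have "\<dots> = \<delta>0" using nw by (simp add: \<delta>_def)
    finally show ?thesis .
  qed
  have upper: "?V (p \<zeta>) \<le> ereal (1 + \<sigma> * ln (cmod \<zeta> / \<delta>))" if \<zeta>: "\<delta> \<le> cmod \<zeta>" for \<zeta>
  proof (rule ccontr)
    assume "\<not> ?thesis"
    then have "ereal (1 + \<sigma> * ln (cmod \<zeta> / \<delta>)) < ?V (p \<zeta>)" by simp
    then obtain f where f: "competitor I S K f" "ereal (1 + \<sigma> * ln (cmod \<zeta> / \<delta>)) < ereal (f (p \<zeta>))"
      using siciak_competitor_approx[OF _ K(1) S(3) pI] by metis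
    have psh: "nonneg_psh I f" using f(1) by (simp add: competitor_def)
    obtain c where c: "\<And>z. z \<in> coord_space I \<Longrightarrow> ereal (f z) \<le> log_supp I S z + ereal c"
      using f(1) by (auto simp: competitor_def)
    have "f (p \<zeta>) \<le> 1 + \<sigma> * ln (cmod \<zeta> / \<delta>)"
    proof (rule log_growth_outside_disc[where v = "\<lambda>\<zeta>. f (p \<zeta>)", OF _ _ \<delta> _ _ \<zeta>])
      show "real_usc UNIV (\<lambda>\<zeta>. f (p \<zeta>))"
        using psh pI unfolding p_def
        by (intro real_usc_compose[OF _ continuous_on_line, of "coord_space I"]) (auto simp: nonneg_psh_def)
      fix \<xi> :: complex
      show "2 * pi * f (p \<xi>) \<le> integral {0..2*pi} h"
        if "continuous_on {0..2*pi} h" "\<And>\<theta>. f (p (\<xi> + of_real r * cis \<theta>)) \<le> h \<theta>" for h r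
      proof (rule nonneg_psh_mean_continuous[OF psh pI _ that(1)])
        show "complex_of_real r *s w \<in> coord_space I" by (intro coord_space_vmult wI)
        have "p (\<xi> + of_real r * cis \<theta>) = p \<xi> + cis \<theta> *s (complex_of_real r *s w)" for \<theta>
          by (simp add: p_def vec_eq_iff algebra_simps)
        then show "f (p \<xi> + cis \<theta> *s (complex_of_real r *s w)) \<le> h \<theta>" for \<theta>
          using that(2)[of \<theta>] by simp
      qed
      show "f (p \<xi>) \<le> 1" if "cmod \<xi> = \<delta>"
      proof -
        have "ereal (f (p \<xi>)) \<le> ?V (p \<xi>)" by (rule competitor_le[OF f(1)])
        also have "\<dots> < 1" using \<delta>0(2)[OF pI near[OF that]] .
        finally show ?thesis by (simp add: one_ereal_def)
      qed
      show "f (p \<xi>) \<le> \<sigma> * ln (cmod \<xi>) + (\<sigma> * ln 2 + c)" if \<xi>: "R \<le> cmod \<xi>"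
      proof -
        have "p \<xi> \<in> coord_torus I"
          using pI p_bounds[OF _ \<xi>] by (force simp: coord_torus_def)
        then have "log_supp I S (p \<xi>) = log_supp_torus S (p \<xi>)" by (simp add: log_supp_def)
        also have "\<dots> \<le> ereal (\<sigma> * ln (2 * cmod \<xi>))"
          unfolding log_supp_torus_eq
        proof (rule SUP_least)
          fix s' assume s': "s' \<in> S"
          have "(\<Sum>i\<in>UNIV. s' $ i * ln (cmod (p \<xi> $ i))) \<le> (\<Sum>i\<in>UNIV. s' $ i * ln (2 * cmod \<xi>))"
          proof (rule sum_mono)
            fix i
            show "s' $ i * ln (cmod (p \<xi> $ i)) \<le> s' $ i * ln (2 * cmod \<xi>)"
            proof (cases "i \<in> I")
              case True
              have "0 < cmod (p \<xi> $ i)" using p_bounds[OF True \<xi>] by linarith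
              then show ?thesis using orth(1)[OF s'] p_bounds(2)[OF True \<xi>]
                by (intro mult_left_mono ln_mono) auto
            qed (simp add: orth(2)[OF s'])
          qed
          also have "\<dots> = (\<Sum>i\<in>UNIV. s' $ i) * ln (2 * cmod \<xi>)" by (simp add: sum_distrib_right)
          also have "\<dots> \<le> \<sigma> * ln (2 * cmod \<xi>)"
            using s(2)[OF s'] \<xi> R0 by (intro mult_right_mono) (auto simp: \<sigma>_def)
          finally show "ereal (\<Sum>i\<in>UNIV. s' $ i * ln (cmod (p \<xi> $ i))) \<le> ereal (\<sigma> * ln (2 * cmod \<xi>))" by simp
        qed
        finally have "log_supp I S (p \<xi>) + ereal c \<le> ereal (\<sigma> * ln (2 * cmod \<xi>)) + ereal c"
          by (rule add_right_mono)
        with c[OF pI] have "ereal (f (p \<xi>)) \<le> ereal (\<sigma> * ln (2 * cmod \<xi>)) + ereal c"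
          by (rule order_trans)
        moreover have "ln (2 * cmod \<xi>) = ln 2 + ln (cmod \<xi>)"
          using \<xi> R0 by (intro ln_mult_pos) auto
        ultimately show ?thesis by (simp add: distrib_left)
      qed
    qed
    then show False using f(2) by simp
  qed
  obtain C where C: "0 \<le> C" "\<And>z. ereal (log_monomial s z - C) \<le> ?V z"
    using siciak_ge_log_monomial[OF S(1,3) s(1) K(2)] by auto
  have lower: "ereal (\<sigma> * ln (cmod \<zeta> / 2) - C) \<le> ?V (p \<zeta>)" if \<zeta>: "R \<le> cmod \<zeta>" for \<zeta>
  proof -
    have "\<sigma> * ln (cmod \<zeta> / 2) = (\<Sum>i\<in>UNIV. s $ i * ln (cmod \<zeta> / 2))"
      by (simp add: \<sigma>_def sum_distrib_right)
    also have "\<dots> \<le> (\<Sum>i\<in>UNIV. s $ i * ln (cmod (p \<zeta> $ i)))"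
    proof (rule sum_mono)
      fix i
      show "s $ i * ln (cmod \<zeta> / 2) \<le> s $ i * ln (cmod (p \<zeta> $ i))"
      proof (cases "i \<in> I")
        case True
        have "0 < cmod \<zeta> / 2" using p_bounds[OF True \<zeta>] by linarith
        then show ?thesis using orth(1)[OF s(1)] p_bounds(1)[OF True \<zeta>]
          by (intro mult_left_mono ln_mono) auto
      qed (simp add: orth(2)[OF s(1)])
    qed
    also have "\<dots> \<le> log_monomial s (p \<zeta>)"
    proof -
      have "p \<zeta> $ i \<noteq> 0" if "0 < s $ i" for i
      proof -
        have "i \<in> I" using orth(2)[OF s(1), of i] that by fastforce
        then show ?thesis using p_bounds(1,3)[OF _ \<zeta>, of i] by auto
      qed
      then show ?thesis using log_monomial_nonzero[OF orth(1)[OF s(1)], of "p \<zeta>"] by simp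
    qed
    finally have "ereal (\<sigma> * ln (cmod \<zeta> / 2) - C) \<le> ereal (log_monomial s (p \<zeta>) - C)" by simp
    then show ?thesis using C(2) by (rule order_trans)
  qed
  define R' where "R' = max R \<delta>"
  have R': "R \<le> R'" "\<delta> \<le> R'" "0 < R'" using R0 by (auto simp: R'_def)
  define B where "B = \<bar>\<sigma> * ln (R' / 2) - C\<bar> + \<bar>1 + \<sigma> * ln (R' / \<delta>)\<bar>"
  have "\<exists>z\<in>coord_space I. \<exists>A. ?V z = ereal A \<and> \<bar>A - t\<bar> \<le> B" if t: "0 \<le> t" for t
  proof -
    define \<zeta> where "\<zeta> = complex_of_real (R' * exp (t / \<sigma>))"
    have n\<zeta>: "cmod \<zeta> = R' * exp (t / \<sigma>)" using R' by (simp add: \<zeta>_def norm_mult)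
    have "1 \<le> exp (t / \<sigma>)" using t \<sigma> by simp
    then have "R' * 1 \<le> R' * exp (t / \<sigma>)" using R' by (intro mult_left_mono) auto
    then have ge: "R' \<le> cmod \<zeta>" using n\<zeta> by simp
    have ln_scaled: "\<sigma> * ln (cmod \<zeta> / d) = t + \<sigma> * ln (R' / d)" if "0 < d" for d
    proof -
      have "cmod \<zeta> / d = exp (t / \<sigma>) * (R' / d)" by (simp add: n\<zeta>)
      also have "ln \<dots> = t / \<sigma> + ln (R' / d)" using that R' by (subst ln_mult_pos) auto
      finally show ?thesis using \<sigma> by (simp add: field_simps)
    qed
    have lo: "ereal (t + (\<sigma> * ln (R' / 2) - C)) \<le> ?V (p \<zeta>)"
      using lower[of \<zeta>] ge R' ln_scaled[of 2] by (simp add: algebra_simps)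
    have up: "?V (p \<zeta>) \<le> ereal (t + (1 + \<sigma> * ln (R' / \<delta>)))"
      using upper[of \<zeta>] ge R' ln_scaled[OF \<delta>] by (simp add: algebra_simps)
    obtain A where A: "?V (p \<zeta>) = ereal A" using lo up by (cases "?V (p \<zeta>)") auto
    then have "\<bar>A - t\<bar> \<le> B" using lo up by (auto simp: B_def)
    then show ?thesis using A pI by blast
  qed
  then show ?thesis by blast
qed

section \<open>Block sums and sublinearity\<close>

lemma coord_proj_glue:
  fixes v :: "'l \<Rightarrow> 'a::zero ^ 'n"
  assumes "\<And>j. v j \<in> coord_space (b -` {j})"
  shows "coord_proj (b -` {j}) (\<chi> i. v (b i) $ i) = v j"
  using assms by (auto simp: coord_proj_def coord_space_def vec_eq_iff)

lemma sum_over_blocks: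
  fixes F :: "'l::finite \<Rightarrow> 'n::finite \<Rightarrow> 'a::comm_monoid_add"
  assumes "\<And>j i. b i \<noteq> j \<Longrightarrow> F j i = 0"
  shows "(\<Sum>i\<in>UNIV. F (b i) i) = (\<Sum>j\<in>UNIV. \<Sum>i\<in>UNIV. F j i)"
proof -
  have "F (b i) i = (\<Sum>j\<in>UNIV. F j i)" for i
    using assms[of i] by (subst sum.mono_neutral_right[of UNIV "{b i}"]) auto
  then have "(\<Sum>i\<in>UNIV. F (b i) i) = (\<Sum>i\<in>UNIV. \<Sum>j\<in>UNIV. F j i)" by simp
  also have "\<dots> = (\<Sum>j\<in>UNIV. \<Sum>i\<in>UNIV. F j i)" by (rule sum.swap)
  finally show ?thesis .
qed

text \<open>
  On the torus, \<open>log_supp_torus S\<close> dominates \<open>\<Sum>\<^sub>j x\<^sub>j log_supp_torus S\<^sub>j\<close> for each \<open>x \<in> T\<close>: almost optimal points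
  \<open>s\<^sub>j \<in> S\<^sub>j\<close> are glued to the point of \<open>S\<close> whose block \<open>j\<close> is \<open>x\<^sub>j s\<^sub>j\<close>.
\<close>

lemma log_supp_torus_block_prod_ge:
  fixes b :: "'n::finite \<Rightarrow> 'l::finite"
  assumes S: "S = (\<Union>x\<in>T. block_prod b (\<lambda>j. (\<lambda>s. (x $ j) *\<^sub>R s) ` Sj j))"
    and Sj: "\<And>j. Sj j \<subseteq> nonneg_orthant (b -` {j})" and x: "x \<in> T" "\<And>j. 0 \<le> x $ j"
    and r: "\<And>j. ereal (r j) < log_supp_torus (Sj j) (coord_proj (b -` {j}) w)"
  shows "ereal (\<Sum>j\<in>UNIV. x $ j * r j) \<le> log_supp_torus S w"
proof -
  let ?w = "\<lambda>j. coord_proj (b -` {j}) w"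
  have "\<exists>s\<in>Sj j. r j < (\<Sum>i\<in>UNIV. s $ i * ln (cmod (?w j $ i)))" for j
    using r[of j] unfolding log_supp_torus_eq by (auto simp: less_SUP_iff)
  then obtain s where s: "\<And>j. s j \<in> Sj j" "\<And>j. r j < (\<Sum>i\<in>UNIV. s j $ i * ln (cmod (?w j $ i)))"
    by metis
  have s0: "s j $ i = 0" if "b i \<noteq> j" for i j
    using Sj[of j] s(1)[of j] that by (auto simp: nonneg_orthant_def coord_space_def)
  define t where "t = (\<chi> i. x $ b i * s (b i) $ i)"
  have "coord_proj (b -` {j}) t = (x $ j) *\<^sub>R s j" for j
    using s0 by (auto simp: t_def coord_proj_def vec_eq_iff)
  then have "t \<in> block_prod b (\<lambda>j. (\<lambda>s. (x $ j) *\<^sub>R s) ` Sj j)"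
    using s(1) by (auto simp: block_prod_def)
  then have "t \<in> S" unfolding S using x(1) by blast
  have "(\<Sum>j\<in>UNIV. x $ j * r j) \<le> (\<Sum>j\<in>UNIV. x $ j * (\<Sum>i\<in>UNIV. s j $ i * ln (cmod (?w j $ i))))"
    using s(2) x(2) by (intro sum_mono mult_left_mono) (auto intro: less_imp_le)
  also have "\<dots> = (\<Sum>j\<in>UNIV. \<Sum>i\<in>UNIV. x $ j * (s j $ i * ln (cmod (?w j $ i))))"
    by (simp add: sum_distrib_left)
  also have "\<dots> = (\<Sum>i\<in>UNIV. x $ b i * (s (b i) $ i * ln (cmod (?w (b i) $ i))))"
    by (rule sum_over_blocks[symmetric]) (simp add: s0)
  also have "\<dots> = (\<Sum>i\<in>UNIV. t $ i * ln (cmod (w $ i)))"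
    by (simp add: t_def coord_proj_def mult.assoc)
  finally have "ereal (\<Sum>j\<in>UNIV. x $ j * r j) \<le> ereal (\<Sum>i\<in>UNIV. t $ i * ln (cmod (w $ i)))" by simp
  also have "\<dots> \<le> log_supp_torus S w"
    using \<open>t \<in> S\<close> by (rule log_supp_torus_upper)
  finally show ?thesis .
qed

text \<open>
  The growth condition is the delicate one, as \<open>log_supp\<close> is an upper limit off the torus. Points of the tori
  of the blocks are chosen independently, each almost optimal near its own projection of \<open>z\<close>, and glued.
  The loss of \<open>1\<close> per block in this approximation is absorbed in the additive constant.
\<close>

lemma competitor_block_sum:
  fixes b :: "'n::finite \<Rightarrow> 'l::finite"
  assumes S: "S = (\<Union>x\<in>T. block_prod b (\<lambda>j. (\<lambda>s. (x $ j) *\<^sub>R s) ` Sj j))"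
    and Sj: "\<And>j. Sj j \<subseteq> nonneg_orthant (b -` {j})" "\<And>j. 0 \<in> Sj j"
    and x: "x \<in> T" "\<And>j. 0 \<le> x $ j"
    and f: "\<And>j. competitor (b -` {j}) (Sj j) (Kj j) (f j)"
  shows "competitor UNIV S (block_prod b Kj) (\<lambda>z. \<Sum>j\<in>UNIV. x $ j * f j (coord_proj (b -` {j}) z))"
proof -
  let ?p = "\<lambda>z j. coord_proj (b -` {j}) z"
  let ?g = "\<lambda>z. \<Sum>j\<in>UNIV. x $ j * f j (?p z j)"
  have "nonneg_psh UNIV ?g"
    using f x(2) by (intro nonneg_psh_sum nonneg_psh_cmult nonneg_psh_coord_proj) (auto simp: competitor_def)
  moreover have "?g w = 0" if "w \<in> block_prod b Kj" for w
    using f that by (auto simp: competitor_def block_prod_def intro!: sum.neutral)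
  moreover have "\<exists>c::real. \<forall>z. ereal (?g z) \<le> log_supp UNIV S z + ereal c"
  proof -
    have "\<forall>j. \<exists>c::real. \<forall>z\<in>coord_space (b -` {j}). ereal (f j z) \<le> log_supp (b -` {j}) (Sj j) z + ereal c"
      using f by (auto simp: competitor_def)
    then obtain c :: "'l \<Rightarrow> real" where
      c: "\<And>j z. z \<in> coord_space (b -` {j}) \<Longrightarrow> ereal (f j z) \<le> log_supp (b -` {j}) (Sj j) z + ereal (c j)"
      by metis
    have "ereal (?g z) \<le> log_supp UNIV S z + ereal (\<Sum>j\<in>UNIV. x $ j * (c j + 1))" for z
    proof -
      define r where "r = (\<lambda>j. f j (?p z j) - c j - 1)"
      have r: "ereal (r j) < log_supp (b -` {j}) (Sj j) (?p z j)" for j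
        using c[OF coord_proj_in, of j z] unfolding r_def
        by (cases "log_supp (b -` {j}) (Sj j) (?p z j)") auto
      have "ereal (\<Sum>j\<in>UNIV. x $ j * r j) \<le> log_supp UNIV S z"
      proof (rule log_supp_ge)
        fix e :: real assume e: "0 < e"
        define e' where "e' = e / (2 * real CARD('l))"
        have e': "0 < e'" using e by (simp add: e'_def)
        have "\<forall>j. \<exists>w\<in>coord_torus (b -` {j}). dist w (?p z j) < e' \<and>
            (?p z j \<in> coord_torus (b -` {j}) \<longrightarrow> w = ?p z j) \<and> ereal (r j) < log_supp_torus (Sj j) w"
          using r e' by (intro allI log_supp_approx coord_proj_in Sj) auto
        then obtain v where v: "\<And>j. v j \<in> coord_torus (b -` {j})" "\<And>j. dist (v j) (?p z j) < e'"
            "\<And>j. ?p z j \<in> coord_torus (b -` {j}) \<Longrightarrow> v j = ?p z j"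
            "\<And>j. ereal (r j) < log_supp_torus (Sj j) (v j)"
          by metis
        define w where "w = (\<chi> i. v (b i) $ i)"
        have pw: "?p w j = v j" for j
          unfolding w_def using v(1) by (intro coord_proj_glue) (auto simp: coord_torus_def)
        have "w \<in> coord_torus UNIV"
          using v(1) by (auto simp: w_def coord_torus_def coord_space_def)
        moreover have "dist w z < e"
        proof -
          have "w - z = (\<Sum>j\<in>UNIV. v j - ?p z j)"
          proof (subst vec_eq_iff, intro allI)
            fix i
            have "(\<Sum>j\<in>UNIV. v j - ?p z j) $ i = (\<Sum>j\<in>UNIV. (v j - ?p z j) $ i)" by simp
            also have "\<dots> = (\<Sum>j\<in>{b i}. (v j - ?p z j) $ i)"
              using v(1) by (intro sum.mono_neutral_right)
                (auto simp: coord_proj_def coord_torus_def coord_space_def)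
            finally show "(w - z) $ i = (\<Sum>j\<in>UNIV. v j - ?p z j) $ i"
              by (simp add: w_def coord_proj_def)
          qed
          then have "dist w z \<le> (\<Sum>j\<in>UNIV. dist (v j) (?p z j))"
            by (simp add: dist_norm norm_sum)
          also have "\<dots> \<le> (\<Sum>j\<in>(UNIV::'l set). e')"
            using v(2) by (intro sum_mono less_imp_le)
          also have "\<dots> < e" using e by (simp add: e'_def)
          finally show ?thesis .
        qed
        moreover have "w = z" if "z \<in> coord_torus UNIV"
        proof -
          have "?p z j \<in> coord_torus (b -` {j})" for j
            using that by (auto simp: coord_torus_def coord_space_def coord_proj_def)
          then have "v j = ?p z j" for j by (rule v(3))
          then show ?thesis by (simp add: w_def coord_proj_def vec_eq_iff)
        qed
        moreover have "ereal (\<Sum>j\<in>UNIV. x $ j * r j) \<le> log_supp_torus S w"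
          using v(4) by (intro log_supp_torus_block_prod_ge[OF S Sj(1) x]) (simp add: pw)
        ultimately show "\<exists>w\<in>coord_torus UNIV. dist w z < e \<and> (z \<in> coord_torus UNIV \<longrightarrow> w = z) \<and>
            ereal (\<Sum>j\<in>UNIV. x $ j * r j) \<le> log_supp_torus S w"
          by blast
      qed
      then have "ereal (\<Sum>j\<in>UNIV. x $ j * r j) + ereal (\<Sum>j\<in>UNIV. x $ j * (c j + 1))
          \<le> log_supp UNIV S z + ereal (\<Sum>j\<in>UNIV. x $ j * (c j + 1))"
        by (rule add_right_mono)
      moreover have "(\<Sum>j\<in>UNIV. x $ j * r j) + (\<Sum>j\<in>UNIV. x $ j * (c j + 1)) = ?g z"
        by (simp add: r_def algebra_simps flip: sum.distrib)
      ultimately show ?thesis by simp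
    qed
    then show ?thesis by blast
  qed
  ultimately show ?thesis by (auto simp: competitor_def)
qed

lemma pluripolar_empty: "pluripolar I {}"
proof -
  have "psh I (\<lambda>_. ereal (0 - 0))"
    by (rule nonneg_psh_imp_psh_minus[OF nonneg_psh_const]) auto
  moreover have "0 \<in> coord_space I" by (simp add: coord_space_def)
  ultimately show ?thesis
    unfolding pluripolar_def by (intro exI[of _ "\<lambda>_. ereal (0 - 0)"]) auto
qed

lemma admissible_weight_const:
  assumes "\<not> pluripolar I K"
  shows "admissible_weight I K (\<lambda>_. ereal c)"
proof -
  have "openin (top_of_set K) {x \<in> K. d < ereal c}" for d
    by (cases "d < ereal c") auto
  then show ?thesis using assms by (simp add: admissible_weight_def lsc_on_def)
qed

lemma supp_fun_real: "supp_fun T (\<lambda>j. ereal (A j)) = (SUP x\<in>T. ereal (\<Sum>j\<in>UNIV. x $ j * A j))"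
  by (simp add: supp_fun_def)

lemma supp_fun_attained:
  fixes T :: "(real ^ 'l::finite) set"
  assumes "compact T" "T \<noteq> {}"
  shows "\<exists>x\<in>T. (\<forall>y\<in>T. (\<Sum>j\<in>UNIV. y $ j * A j) \<le> (\<Sum>j\<in>UNIV. x $ j * A j)) \<and>
    supp_fun T (\<lambda>j. ereal (A j)) = ereal (\<Sum>j\<in>UNIV. x $ j * A j)"
proof -
  have "continuous_on T (\<lambda>x. \<Sum>j\<in>UNIV. x $ j * A j)" by (intro continuous_intros)
  then obtain x where x: "x \<in> T" "\<forall>y\<in>T. (\<Sum>j\<in>UNIV. y $ j * A j) \<le> (\<Sum>j\<in>UNIV. x $ j * A j)"
    using continuous_attains_sup[OF assms] by blast
  moreover have "supp_fun T (\<lambda>j. ereal (A j)) = ereal (\<Sum>j\<in>UNIV. x $ j * A j)"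
    unfolding supp_fun_real using x by (intro antisym SUP_least SUP_upper2[of x]) auto
  ultimately show ?thesis by blast
qed

text \<open>
  If a point \<open>x\<close> of \<open>T\<close> maximizes the pairing with \<open>A + c\<close> and equality held in the sublinearity estimate, then
  \<open>x\<close> would maximize the pairing with \<open>c\<close>. But for \<open>A\<close> within \<open>B\<close> of \<open>-t c\<close>, passing from \<open>x\<close> to the point \<open>y\<close>
  changes the pairing with \<open>A\<close> by \<open>t d\<close> up to a bounded error, where \<open>d > 0\<close> is the drop of the pairing with
  \<open>c\<close>. So \<open>y\<close> does better for \<open>A\<close> as soon as \<open>t d\<close> exceeds that error.
\<close>

lemma supp_fun_gap:
  fixes T :: "(real ^ 'l::finite) set"
  assumes T: "compact T" "y \<in> T" "y' \<in> T" and lt: "(\<Sum>j\<in>UNIV. y $ j * c j) < (\<Sum>j\<in>UNIV. y' $ j * c j)"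
  shows "\<exists>t\<ge>0. \<forall>A. (\<forall>j. \<bar>A j - t * (- c j)\<bar> \<le> B j) \<longrightarrow>
    (\<exists>x\<in>T. supp_fun T (\<lambda>j. ereal (A j + c j)) < ereal (\<Sum>j\<in>UNIV. x $ j * A j) + supp_fun T (\<lambda>j. ereal (c j)))"
proof -
  have ne: "T \<noteq> {}" using T by auto
  obtain m where m: "m \<in> T" "\<And>x. x \<in> T \<Longrightarrow> (\<Sum>j\<in>UNIV. x $ j * c j) \<le> (\<Sum>j\<in>UNIV. m $ j * c j)"
      "supp_fun T (\<lambda>j. ereal (c j)) = ereal (\<Sum>j\<in>UNIV. m $ j * c j)"
    using supp_fun_attained[OF T(1) ne, of c] by blast
  define d where "d = (\<Sum>j\<in>UNIV. m $ j * c j) - (\<Sum>j\<in>UNIV. y $ j * c j)"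
  have d: "0 < d" using lt m(2)[OF T(3)] by (simp add: d_def)
  obtain M where M: "\<And>x. x \<in> T \<Longrightarrow> norm x \<le> M"
    using compact_imp_bounded[OF T(1)] by (auto simp: bounded_iff)
  have M0: "0 \<le> M" using M[OF T(2)] norm_ge_zero order_trans by blast
  define t where "t = (\<Sum>j\<in>UNIV. 2 * M * \<bar>B j\<bar>) / d + 1"
  have t: "0 \<le> t" "(\<Sum>j\<in>UNIV. 2 * M * \<bar>B j\<bar>) < t * d"
    using d M0 by (auto simp: t_def field_simps intro!: add_nonneg_nonneg divide_nonneg_nonneg sum_nonneg)
  have "\<exists>x\<in>T. supp_fun T (\<lambda>j. ereal (A j + c j)) < ereal (\<Sum>j\<in>UNIV. x $ j * A j) + supp_fun T (\<lambda>j. ereal (c j))"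
    if A: "\<And>j. \<bar>A j - t * (- c j)\<bar> \<le> B j" for A
  proof -
    obtain x where x: "x \<in> T"
        "supp_fun T (\<lambda>j. ereal (A j + c j)) = ereal (\<Sum>j\<in>UNIV. x $ j * (A j + c j))"
      using supp_fun_attained[OF T(1) ne, of "\<lambda>j. A j + c j"] by blast
    have split: "(\<Sum>j\<in>UNIV. x $ j * (A j + c j)) = (\<Sum>j\<in>UNIV. x $ j * A j) + (\<Sum>j\<in>UNIV. x $ j * c j)"
      by (simp add: distrib_left sum.distrib)
    show ?thesis
    proof (cases "(\<Sum>j\<in>UNIV. x $ j * c j) < (\<Sum>j\<in>UNIV. m $ j * c j)")
      case True
      then show ?thesis using x m(3) split by (intro bexI[of _ x]) auto
    next
      case False
      then have xm: "(\<Sum>j\<in>UNIV. x $ j * c j) = (\<Sum>j\<in>UNIV. m $ j * c j)" using m(2)[OF x(1)] by simp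
      have "(\<Sum>j\<in>UNIV. x $ j * A j) - (\<Sum>j\<in>UNIV. y $ j * A j) + t * d
          = (\<Sum>j\<in>UNIV. (x $ j - y $ j) * (A j - t * (- c j)))"
        unfolding d_def xm[symmetric]
        by (simp add: algebra_simps sum.distrib sum_subtractf sum_distrib_left)
      also have "\<dots> \<le> (\<Sum>j\<in>UNIV. 2 * M * \<bar>B j\<bar>)"
      proof (rule sum_mono)
        fix j
        have "\<bar>x $ j - y $ j\<bar> \<le> 2 * M"
          using component_le_norm_cart[of x j] component_le_norm_cart[of y j] M[OF x(1)] M[OF T(2)] by linarith
        then have "\<bar>x $ j - y $ j\<bar> * \<bar>A j - t * (- c j)\<bar> \<le> 2 * M * \<bar>B j\<bar>"
          using A[of j] by (intro mult_mono) auto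
        then show "(x $ j - y $ j) * (A j - t * (- c j)) \<le> 2 * M * \<bar>B j\<bar>"
          by (metis abs_ge_self abs_mult order_trans)
      qed
      finally have "(\<Sum>j\<in>UNIV. x $ j * A j) < (\<Sum>j\<in>UNIV. y $ j * A j)" using t(2) by linarith
      then show ?thesis using x(2) m(3) split xm T(2) by (intro bexI[of _ y]) auto
    qed
  qed
  then show ?thesis using t(1) by blast
qed

section \<open>Strict inequality for constant weights\<close>

text \<open>
  The half \<open>V \<ge> \<phi>\<^sub>T(V\<^sub>1, \<dots>, V\<^sub>\<ell>)\<close> of the product formula, for each \<open>x \<in> T\<close> separately, with a constant weight:
  almost optimal candidates in the factors are combined by \<open>competitor_block_sum\<close>.
\<close>

lemma siciak_block_prod_ge:
  fixes b :: "'n::finite \<Rightarrow> 'l::finite"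
  assumes S: "S = (\<Union>x\<in>T. block_prod b (\<lambda>j. (\<lambda>s. (x $ j) *\<^sub>R s) ` Sj j))"
    and Sj: "\<And>j. Sj j \<subseteq> nonneg_orthant (b -` {j})" "\<And>j. 0 \<in> Sj j"
    and Kj: "\<And>j. Kj j \<subseteq> coord_space (b -` {j})"
    and x: "x \<in> T" "\<And>j. 0 \<le> x $ j"
    and A: "\<And>j. siciak_zakharyuta (b -` {j}) (Sj j) (Kj j) (\<lambda>_. 0) (coord_proj (b -` {j}) z) = ereal (A j)"
    and C: "C \<le> 0"
  shows "ereal (\<Sum>j\<in>UNIV. x $ j * A j) + ereal C \<le> siciak_zakharyuta UNIV S (block_prod b Kj) (\<lambda>_. ereal C) z"
proof (rule ereal_le_epsilon2)
  fix e :: real assume e: "0 < e"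
  let ?p = "\<lambda>z j. coord_proj (b -` {j}) z"
  \<comment> \<open>The summand \<open>1\<close> keeps \<open>D\<close> positive when \<open>x = 0\<close>.\<close>
  define D where "D = (\<Sum>j\<in>UNIV. x $ j) + 1"
  have D: "0 < D" using x(2) by (auto simp: D_def intro!: add_nonneg_pos sum_nonneg)
  have "\<exists>f. competitor (b -` {j}) (Sj j) (Kj j) f \<and> ereal (A j - e / D) < ereal (f (?p z j))" for j
    using A[of j] e D by (intro siciak_competitor_approx Kj Sj coord_proj_in) simp
  then obtain f where f: "\<And>j. competitor (b -` {j}) (Sj j) (Kj j) (f j)" "\<And>j. A j - e / D < f j (?p z j)"
    by (metis less_ereal.simps(1))
  define g where "g = (\<lambda>z. \<Sum>j\<in>UNIV. x $ j * f j (?p z j))"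
  have g: "competitor UNIV S (block_prod b Kj) g"
    unfolding g_def by (rule competitor_block_sum[OF S Sj x f(1)])
  then obtain c where "nonneg_psh UNIV g" "\<forall>z\<in>coord_space UNIV. ereal (g z) \<le> log_supp UNIV S z + ereal c"
      "\<forall>w\<in>block_prod b Kj. g w = 0"
    by (auto simp: competitor_def)
  then have V: "ereal (g z - (- C)) \<le> siciak_zakharyuta UNIV S (block_prod b Kj) (\<lambda>_. ereal C) z"
    using C by (intro competitor_minus_const_le) auto
  have "(\<Sum>j\<in>UNIV. x $ j * A j) - e \<le> (\<Sum>j\<in>UNIV. x $ j * A j) - (\<Sum>j\<in>UNIV. x $ j) * (e / D)"
    using e D by (simp add: D_def field_simps)
  also have "\<dots> = (\<Sum>j\<in>UNIV. x $ j * (A j - e / D))"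
    by (simp add: right_diff_distrib sum_subtractf sum_distrib_right sum_divide_distrib)
  also have "\<dots> \<le> g z"
    unfolding g_def using f(2) x(2) by (intro sum_mono mult_left_mono) (auto intro: less_imp_le)
  finally have "ereal ((\<Sum>j\<in>UNIV. x $ j * A j) + C) \<le> ereal (g z - (- C)) + ereal e" by simp
  also have "\<dots> \<le> siciak_zakharyuta UNIV S (block_prod b Kj) (\<lambda>_. ereal C) z + ereal e"
    using V by (rule add_right_mono)
  finally show "ereal (\<Sum>j\<in>UNIV. x $ j * A j) + ereal C
      \<le> siciak_zakharyuta UNIV S (block_prod b Kj) (\<lambda>_. ereal C) z + ereal e" by simp
qed

text \<open>
  The points \<open>z\<^sub>j\<close> are chosen with \<open>V\<^sub>j(z\<^sub>j)\<close> within a bounded distance of \<open>-t c\<^sub>j\<close>, where \<open>t\<close> is the number that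
  \<open>supp_fun_gap\<close> provides for this bound. The sign of \<open>c\<close> makes these values nonnegative, hence attainable,
  and the weight on the product nonpositive.
\<close>

lemma strict_inequality_const_weights:
  fixes b :: "'n::finite \<Rightarrow> 'l::finite"
  assumes Kj: "\<And>j. Kj j \<subseteq> coord_space (b -` {j})" "\<And>j. compact (Kj j)" "\<And>j. Kj j \<noteq> {}"
    and T: "T \<subseteq> nonneg_orthant UNIV" "compact T"
    and Sj: "\<And>j. Sj j \<subseteq> nonneg_orthant (b -` {j})" "\<And>j. compact (Sj j)" "\<And>j. 0 \<in> Sj j" "\<And>j. Sj j \<noteq> {0}"
    and V0: "\<And>j z. z \<in> Kj j \<Longrightarrow>
      usc_reg (coord_space (b -` {j})) (siciak_zakharyuta (b -` {j}) (Sj j) (Kj j) (\<lambda>_. 0)) z = 0"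
    and S: "S = (\<Union>x\<in>T. block_prod b (\<lambda>j. (\<lambda>s. (x $ j) *\<^sub>R s) ` Sj j))"
    and c: "\<And>j. c j \<le> 0"
    and y: "y \<in> T" "y' \<in> T" "(\<Sum>j\<in>UNIV. y $ j * c j) \<noteq> (\<Sum>j\<in>UNIV. y' $ j * c j)"
  shows "\<exists>z. supp_fun T (\<lambda>j. siciak_zakharyuta (b -` {j}) (Sj j) (Kj j) (\<lambda>_. ereal (c j)) (coord_proj (b -` {j}) z))
    < siciak_zakharyuta UNIV S (block_prod b Kj) (\<lambda>_. supp_fun T (\<lambda>j. ereal (c j))) z"
proof -
  let ?V = "\<lambda>j. siciak_zakharyuta (b -` {j}) (Sj j) (Kj j)"
  have T0: "0 \<le> x $ j" if "x \<in> T" for x j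
    using T(1) that by (auto simp: nonneg_orthant_def)
  have "\<exists>B. \<forall>t\<ge>0. \<exists>z\<in>coord_space (b -` {j}). \<exists>A. ?V j (\<lambda>_. 0) z = ereal A \<and> \<bar>A - t\<bar> \<le> B" for j
  proof -
    obtain a where "a \<in> Kj j" using Kj(3) by blast
    then show ?thesis using V0 by (intro siciak_line_growth[OF Sj Kj(1,2)])
  qed
  then obtain B where B: "\<And>j t. 0 \<le> t \<Longrightarrow>
      \<exists>z\<in>coord_space (b -` {j}). \<exists>A. ?V j (\<lambda>_. 0) z = ereal A \<and> \<bar>A - t\<bar> \<le> B j"
    by metis
  obtain t where t: "0 \<le> t" "\<And>A. (\<And>j. \<bar>A j - t * (- c j)\<bar> \<le> B j) \<Longrightarrow>
    \<exists>x\<in>T. supp_fun T (\<lambda>j. ereal (A j + c j)) < ereal (\<Sum>j\<in>UNIV. x $ j * A j) + supp_fun T (\<lambda>j. ereal (c j))"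
  proof (cases "(\<Sum>j\<in>UNIV. y $ j * c j) < (\<Sum>j\<in>UNIV. y' $ j * c j)")
    case True
    then show ?thesis using supp_fun_gap[OF T(2) y(1,2) True, of B] that by blast
  next
    case False
    then have "(\<Sum>j\<in>UNIV. y' $ j * c j) < (\<Sum>j\<in>UNIV. y $ j * c j)" using y(3) by simp
    then show ?thesis using supp_fun_gap[OF T(2) y(2,1), of c B] that by blast
  qed
  have "\<exists>z A. z \<in> coord_space (b -` {j}) \<and> ?V j (\<lambda>_. 0) z = ereal A \<and> \<bar>A - t * (- c j)\<bar> \<le> B j" for j
    using B[of "t * (- c j)" j] t(1) c[of j] by (auto simp: mult_nonneg_nonpos)
  then obtain v A where v: "\<And>j. v j \<in> coord_space (b -` {j})" "\<And>j. ?V j (\<lambda>_. 0) (v j) = ereal (A j)"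
      "\<And>j. \<bar>A j - t * (- c j)\<bar> \<le> B j"
    by metis
  define z where "z = (\<chi> i. v (b i) $ i)"
  have pz: "coord_proj (b -` {j}) z = v j" for j
    unfolding z_def by (rule coord_proj_glue[OF v(1)])
  obtain C where C: "supp_fun T (\<lambda>j. ereal (c j)) = ereal C" "C \<le> 0"
  proof -
    obtain m where m: "m \<in> T" "supp_fun T (\<lambda>j. ereal (c j)) = ereal (\<Sum>j\<in>UNIV. m $ j * c j)"
      using supp_fun_attained[OF T(2), of c] y(1) by blast
    moreover have "(\<Sum>j\<in>UNIV. m $ j * c j) \<le> 0"
      using c T0[OF m(1)] by (intro sum_nonpos mult_nonneg_nonpos) auto
    ultimately show ?thesis using that by blast
  qed
  obtain x where x: "x \<in> T" "supp_fun T (\<lambda>j. ereal (A j + c j)) < ereal (\<Sum>j\<in>UNIV. x $ j * A j) + ereal C"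
    using t(2)[OF v(3)] C(1) by auto
  have "supp_fun T (\<lambda>j. ?V j (\<lambda>_. ereal (c j)) (v j)) \<le> supp_fun T (\<lambda>j. ereal (A j + c j))"
    unfolding supp_fun_def
  proof (rule SUP_subset_mono[OF order_refl], rule sum_mono)
    fix x j assume "x \<in> T"
    have "?V j (\<lambda>_. ereal (c j)) (v j) \<le> ereal (A j + c j)"
      using siciak_shift_le[OF c[of j] Kj(1)[of j] Sj(3)[of j] v(1)[of j]] v(2)[of j] by simp
    then show "ereal (x $ j) * ?V j (\<lambda>_. ereal (c j)) (v j) \<le> ereal (x $ j) * ereal (A j + c j)"
      using T0[OF \<open>x \<in> T\<close>] by (intro ereal_mult_left_mono) auto
  qed
  also note x(2)
  also have "ereal (\<Sum>j\<in>UNIV. x $ j * A j) + ereal C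
      \<le> siciak_zakharyuta UNIV S (block_prod b Kj) (\<lambda>_. ereal C) z"
    using v(2) by (intro siciak_block_prod_ge[OF S Sj(1,3) Kj(1) x(1) T0[OF x(1)] _ C(2)]) (simp add: pz)
  finally have "supp_fun T (\<lambda>j. ?V j (\<lambda>_. ereal (c j)) (coord_proj (b -` {j}) z))
      < siciak_zakharyuta UNIV S (block_prod b Kj) (\<lambda>_. supp_fun T (\<lambda>j. ereal (c j))) z"
    by (simp add: pz C(1))
  then show ?thesis by blast
qed

lemma convex_body_nonconstant_pairing:
  fixes T :: "(real ^ 'l::finite) set"
  assumes "convex_body T" "c i \<noteq> 0"
  shows "\<exists>x\<in>T. \<exists>y\<in>T. (\<Sum>j\<in>UNIV. x $ j * c j) \<noteq> (\<Sum>j\<in>UNIV. y $ j * c j)"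
proof -
  obtain x where "x \<in> interior T" using assms(1) by (auto simp: convex_body_def)
  then obtain e where e: "0 < e" "cball x e \<subseteq> T" by (auto simp: mem_interior_cball)
  define y where "y = x + e *\<^sub>R axis i 1"
  have "y \<in> cball x e" using e by (simp add: y_def dist_norm norm_axis_1)
  moreover have "x \<in> cball x e" using e by simp
  moreover have "(\<Sum>j\<in>UNIV. y $ j * c j) = (\<Sum>j\<in>UNIV. x $ j * c j) + e * c i"
  proof -
    have "y $ j * c j = x $ j * c j + (if j = i then e * c i else 0)" for j
      by (simp add: y_def axis_def distrib_right)
    then show ?thesis by (simp add: sum.distrib)
  qed
  ultimately show ?thesis using e assms(2) by (intro bexI[of _ x] bexI[of _ y]) auto
qed

theorem proposition4p1:
  fixes b :: "'n::finite \<Rightarrow> 'l::finite"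
    and I :: "'l \<Rightarrow> 'n set"
    and Kj :: "'l \<Rightarrow> (complex ^ 'n) set"
    and K :: "(complex ^ 'n) set"
    and T :: "(real ^ 'l) set"
    and Sj :: "'l \<Rightarrow> (real ^ 'n) set"
    and S :: "(real ^ 'n) set"
  assumes b: "surj b"
    and I: "I = (\<lambda>j. b -` {j})"
    and Kj: "\<And>j. Kj j \<subseteq> coord_space (I j)" "\<And>j. compact (Kj j)"
      "\<And>j. \<not> pluripolar (I j) (Kj j)"
    and T: "T \<subseteq> nonneg_orthant UNIV" "compact T" "convex T" "\<exists>x\<in>T. \<exists>y\<in>T. x \<noteq> y"
    and Sj: "\<And>j. Sj j \<subseteq> nonneg_orthant (I j)" "\<And>j. compact (Sj j)" "\<And>j. convex (Sj j)"
      "\<And>j. 0 \<in> Sj j" "\<And>j. Sj j \<noteq> {0}"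
    and V0: "\<And>j z. z \<in> Kj j \<Longrightarrow>
      usc_reg (coord_space (I j)) (siciak_zakharyuta (I j) (Sj j) (Kj j) (\<lambda>_. 0)) z = 0"
    and K: "K = block_prod b Kj"
    and S: "S = (\<Union>x\<in>T. block_prod b (\<lambda>j. (\<lambda>s. (x $ j) *\<^sub>R s) ` Sj j))"
  shows "(\<exists>q :: 'l \<Rightarrow> complex ^ 'n \<Rightarrow> ereal.
            (\<forall>j. admissible_weight (I j) (Kj j) (q j)) \<and>
            (\<exists>z. siciak_zakharyuta UNIV S K (\<lambda>w. supp_fun T (\<lambda>j. q j (coord_proj (I j) w))) z
                  > supp_fun T (\<lambda>j. siciak_zakharyuta (I j) (Sj j) (Kj j) (q j) (coord_proj (I j) z))))
       \<and> (convex_body T \<longrightarrow>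
            (\<forall>c :: 'l \<Rightarrow> real. (\<forall>j. c j < 0) \<longrightarrow>
              (\<exists>z. siciak_zakharyuta UNIV S K (\<lambda>_. supp_fun T (\<lambda>j. ereal (c j))) z
                  > supp_fun T (\<lambda>j. siciak_zakharyuta (I j) (Sj j) (Kj j) (\<lambda>_. ereal (c j))
                                      (coord_proj (I j) z)))))"
proof -
  have ne: "Kj j \<noteq> {}" for j using Kj(3)[of j] pluripolar_empty by metis
  have strict: "\<exists>z. supp_fun T (\<lambda>j. siciak_zakharyuta (I j) (Sj j) (Kj j) (\<lambda>_. ereal (c j)) (coord_proj (I j) z))
      < siciak_zakharyuta UNIV S K (\<lambda>_. supp_fun T (\<lambda>j. ereal (c j))) z"
    if "\<And>j. c j \<le> 0" "y \<in> T" "y' \<in> T" "(\<Sum>j\<in>UNIV. y $ j * c j) \<noteq> (\<Sum>j\<in>UNIV. y' $ j * c j)" for c y y'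
    unfolding I K
    by (rule strict_inequality_const_weights[OF Kj(1,2)[unfolded I] ne T(1,2) Sj(1,2,4,5)[unfolded I]
          V0[unfolded I] S that])
  obtain y y' j where y: "y \<in> T" "y' \<in> T" "y $ j \<noteq> y' $ j"
    using T(4) by (auto simp: vec_eq_iff)
  \<comment> \<open>Pairing with \<open>-e\<^sub>j\<close> separates two points of \<open>T\<close> that differ in the coordinate \<open>j\<close>.\<close>
  define c where "c = (\<lambda>i. if i = j then - 1 else 0 :: real)"
  have pair: "(\<Sum>i\<in>UNIV. x $ i * c i) = - x $ j" for x :: "real ^ 'l"
    by (simp add: c_def if_distrib[of "\<lambda>r. _ * r"] cong: if_cong)
  have "\<exists>z. supp_fun T (\<lambda>j. siciak_zakharyuta (I j) (Sj j) (Kj j) (\<lambda>_. ereal (c j)) (coord_proj (I j) z))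
      < siciak_zakharyuta UNIV S K (\<lambda>_. supp_fun T (\<lambda>j. ereal (c j))) z"
    using y by (intro strict[of c y y']) (auto simp: pair, simp add: c_def)
  then have first: "\<exists>q. (\<forall>j. admissible_weight (I j) (Kj j) (q j)) \<and>
            (\<exists>z. siciak_zakharyuta UNIV S K (\<lambda>w. supp_fun T (\<lambda>j. q j (coord_proj (I j) w))) z
                  > supp_fun T (\<lambda>j. siciak_zakharyuta (I j) (Sj j) (Kj j) (q j) (coord_proj (I j) z)))"
    using admissible_weight_const[OF Kj(3)] by (intro exI[of _ "\<lambda>j _. ereal (c j)"]) auto
  have second: "\<exists>z. siciak_zakharyuta UNIV S K (\<lambda>_. supp_fun T (\<lambda>j. ereal (c j))) z
      > supp_fun T (\<lambda>j. siciak_zakharyuta (I j) (Sj j) (Kj j) (\<lambda>_. ereal (c j)) (coord_proj (I j) z))"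
    if body: "convex_body T" and c: "\<forall>j. c j < 0" for c :: "'l \<Rightarrow> real"
  proof -
    have "c j \<noteq> 0" using c by (metis less_irrefl)
    then obtain x y where "x \<in> T" "y \<in> T" "(\<Sum>j\<in>UNIV. x $ j * c j) \<noteq> (\<Sum>j\<in>UNIV. y $ j * c j)"
      using convex_body_nonconstant_pairing[OF body] by blast
    then show ?thesis using c by (intro strict) (auto intro: less_imp_le)
  qed
  from first second show ?thesis by blast
qed

end
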